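(* Let $\Phi\in\mathrm{End}(\mathcal{Q})$ and $n\ge0$. Suppose that $\Phi_n$ has the partitioning property (with set of equivalence classes $E$) and that the numbers $c_{\alpha,(n)}$, $\alpha\in\operatorname{Comp}(n)$, are nonnegative and not all zero. Then $\widehat{K}$ is a stochastic matrix and it lumps $K$ by equivalence classes: for all $A,B\in E$ and all $\pi,\tau\in\mathfrak{S}_n$ with $D(\pi),D(\tau)\in A$, $$\sum_{\sigma\in\mathfrak{S}_n:\,D(\sigma)\in B}K(\pi,\sigma)=\sum_{\sigma\in\mathfrak{S}_n:\,D(\sigma)\in B}K(\tau,\sigma)=\widehat{K}(A,B).$$
   Context: Work over $\mathbb{Q}$. Compositions $\alpha=(a_1,\dots,a_k)$ of $n$, $\operatorname{Comp}(n)$, $(n)$, $S_\alpha=\{a_1,\dots,a_1+\dots+a_{k-1}\}$, $\operatorname{co}$ its inverse, $\alpha\le\beta$ iff $S_\alpha\subseteq S_\beta$. $M_\alpha=\sum_{i_1<\dots<i_k}x_{i_1}^{a_1}\cdots x_{i_k}^{a_k}$, $\mathcal{Q}_n$ their span over $\operatorname{Comp}(n)$, $\mathcal{Q}$ the graded Hopf algebra of quasisymmetric functions (coproduct by deconcatenation of $M_\alpha$), $F_\alpha=\sum_{\beta\ge\alpha}M_\beta$. $\mathrm{End}(\mathcal{Q})$ = graded Hopf algebra endomorphisms, $\Phi_n=\Phi|_{\mathcal{Q}_n}$. For $\sigma\in\mathfrak{S}_n$, $D(\sigma)=\operatorname{co}(\{i:\sigma_i>\sigma_{i+1}\})$; product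 is composition. Define $c_{\alpha,\beta}$ by $\Phi(F_\alpha)=\sum_\beta c_{\alpha,\beta}F_\beta$, $\lambda$ by $\Phi(M_{(1)})=\lambda M_{(1)}$, $\mathrm{Prob}_\Phi(\pi)=c_{D(\pi),(n)}/\sum_\sigma c_{D(\sigma),(n)}$, $K(\pi,\sigma\pi)=\mathrm{Prob}_\Phi(\sigma^{-1})$. $\Phi_n$ has the partitioning property if there is an equivalence relation on $\operatorname{Comp}(n)$, with set of classes $E$, such that $\Phi(F_\alpha)=\Phi(F_\beta)$ whenever $\alpha,\beta$ are equivalent, and, writing $\phi_A=\Phi(F_\alpha)$ for any $\alpha\in A\in E$, the family $\{\phi_A\}_{A\in E}$ is a basis of $\Phi(\mathcal{Q}_n)$. Then define $d_{A,B}$ by $\Phi(\phi_A)=\sum_{B\in E}d_{A,B}\phi_B$ and, when $\lambda^n\ne0$, $\widehat{K}(A,B)=d_{A,B}/\lambda^n$. *)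

theory Defs
  imports
    Complex_Main
    "HOL-Library.Multiset"
    "HOL-Library.Function_Algebras"
    "HOL-Combinatorics.Permutations"
begin

section \<open>Compositions\<close>

definition Comp :: "nat \<Rightarrow> nat list set" where
  "Comp n = {\<alpha>. sum_list \<alpha> = n \<and> 0 \<notin> set \<alpha>}"

definition Compositions :: "nat list set" where
  "Compositions = (\<Union>n. Comp n)"

text \<open>The composition \<open>(n)\<close>; for \<open>n = 0\<close> the only composition of \<open>n\<close> is the empty one.\<close>

definition one_part :: "nat \<Rightarrow> nat list" where
  "one_part n = (if n = 0 then [] else [n])"

definition partial_sums :: "nat list \<Rightarrow> nat set" where
  "partial_sums \<alpha> = {sum_list (take i \<alpha>) | i. 1 \<le> i \<and> i < length \<alpha>}"

definition co :: "nat \<Rightarrow> nat set \<Rightarrow> nat list" where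
  "co n = inv_into (Comp n) partial_sums"

definition comp_le :: "nat list \<Rightarrow> nat list \<Rightarrow> bool" where
  "comp_le \<alpha> \<beta> \<longleftrightarrow> sum_list \<alpha> = sum_list \<beta> \<and> partial_sums \<alpha> \<subseteq> partial_sums \<beta>"


section \<open>Quasisymmetric functions\<close>

text \<open>
  The variables are indexed by \<open>nat\<close>, starting at 0. A monomial is the multiset of the indices
  of its variables, so that multiset union is multiplication of monomials; a formal power series
  maps each monomial to its coefficient. Sums of power series are the pointwise sums of
  \<open>Function_Algebras\<close>, but their product is \<open>series_mult\<close> and their unit \<open>series_one\<close>: the
  pointwise \<open>*\<close> and \<open>1\<close> of \<open>Function_Algebras\<close> are never used.
\<close>

type_synonym series = "nat multiset \<Rightarrow> rat"

definition fscale :: "rat \<Rightarrow> ('a \<Rightarrow> rat) \<Rightarrow> 'a \<Rightarrow> rat" (infixr "*\<^sub>f" 75) where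
  "c *\<^sub>f f = (\<lambda>x. c * f x)"

interpretation fs: vector_space fscale
  by unfold_locales (auto simp: fscale_def fun_eq_iff algebra_simps)

definition series_one :: series where
  "series_one = (\<lambda>m. if m = {#} then 1 else 0)"

definition series_mult :: "series \<Rightarrow> series \<Rightarrow> series" (infixl "\<odot>" 70) where
  "f \<odot> g = (\<lambda>m. \<Sum>(u, v)\<in>{(u, v). u + v = m}. f u * g v)"

text \<open>
  The coefficient of a monomial in \<open>M \<alpha>\<close> is the number of sequences
  \<open>i\<^sub>1 < \<dots> < i\<^sub>k\<close> whose term \<open>x\<^bsub>i\<^sub>1\<^esub>\<^bsup>a\<^sub>1\<^esup> \<cdots> x\<^bsub>i\<^sub>k\<^esub>\<^bsup>a\<^sub>k\<^esup>\<close> is that monomial.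
\<close>

definition M :: "nat list \<Rightarrow> series" where
  "M \<alpha> = (\<lambda>m. of_nat (card {is. length is = length \<alpha> \<and> sorted_wrt (<) is \<and>
                                 m = (\<Sum>j<length \<alpha>. replicate_mset (\<alpha> ! j) (is ! j))}))"

definition Q :: "nat \<Rightarrow> series set" where
  "Q n = fs.span (M ` Comp n)"

definition QSym :: "series set" where
  "QSym = fs.span (M ` Compositions)"

definition F :: "nat list \<Rightarrow> series" where
  "F \<alpha> = (\<Sum>\<beta>\<in>{\<beta>\<in>Comp (sum_list \<alpha>). comp_le \<alpha> \<beta>}. M \<beta>)"


section \<open>Graded Hopf algebra endomorphisms\<close>

definition Mcoeff :: "series \<Rightarrow> nat list \<Rightarrow> rat" where
  "Mcoeff f \<alpha> = fs.representation (M ` Compositions) f (M \<alpha>)"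

definition counit :: "series \<Rightarrow> rat" where
  "counit f = Mcoeff f []"

text \<open>
  The tensor square of \<open>QSym\<close> is realised inside the power series in two sets of variables, with
  \<open>f \<otimes> g\<close> being the product \<open>f(x) g(y)\<close>.
\<close>

type_synonym series2 = "nat multiset \<times> nat multiset \<Rightarrow> rat"

definition tensor :: "series \<Rightarrow> series \<Rightarrow> series2" (infixr "\<otimes>" 76) where
  "f \<otimes> g = (\<lambda>(u, v). f u * g v)"

definition coproduct :: "series \<Rightarrow> series2" where
  "coproduct f = (\<Sum>\<alpha>\<in>{\<alpha>\<in>Compositions. Mcoeff f \<alpha> \<noteq> 0}.
     Mcoeff f \<alpha> *\<^sub>f (\<Sum>i\<le>length \<alpha>. M (take i \<alpha>) \<otimes> M (drop i \<alpha>)))"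

definition MMcoeff :: "series2 \<Rightarrow> nat list \<Rightarrow> nat list \<Rightarrow> rat" where
  "MMcoeff t \<alpha> \<beta> =
     fs.representation {M \<gamma> \<otimes> M \<delta> | \<gamma> \<delta>. \<gamma> \<in> Compositions \<and> \<delta> \<in> Compositions} t (M \<alpha> \<otimes> M \<beta>)"

text \<open>\<open>tensor_square \<Phi>\<close> is \<open>\<Phi> \<otimes> \<Phi>\<close> on the tensor square of \<open>QSym\<close>, for \<open>\<Phi>\<close> linear on \<open>QSym\<close>.\<close>

definition tensor_square :: "(series \<Rightarrow> series) \<Rightarrow> series2 \<Rightarrow> series2" where
  "tensor_square \<Phi> t =
     (\<Sum>(\<alpha>, \<beta>)\<in>{(\<alpha>, \<beta>). \<alpha> \<in> Compositions \<and> \<beta> \<in> Compositions \<and> MMcoeff t \<alpha> \<beta> \<noteq> 0}.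
        MMcoeff t \<alpha> \<beta> *\<^sub>f (\<Phi> (M \<alpha>) \<otimes> \<Phi> (M \<beta>)))"

text \<open>
  Only the values of \<open>\<Phi>\<close> on \<open>QSym\<close> matter. Compatibility with the antipode is automatic for
  bialgebra morphisms between Hopf algebras and is not listed.
\<close>

definition QSym_End :: "(series \<Rightarrow> series) set" where
  "QSym_End = {\<Phi>.
     (\<forall>f\<in>QSym. \<forall>g\<in>QSym. \<Phi> (f + g) = \<Phi> f + \<Phi> g) \<and>
     (\<forall>c. \<forall>f\<in>QSym. \<Phi> (c *\<^sub>f f) = c *\<^sub>f \<Phi> f) \<and>
     (\<forall>n. \<Phi> ` Q n \<subseteq> Q n) \<and>
     \<Phi> series_one = series_one \<and>
     (\<forall>f\<in>QSym. \<forall>g\<in>QSym. \<Phi> (f \<odot> g) = \<Phi> f \<odot> \<Phi> g) \<and>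
     (\<forall>f\<in>QSym. counit (\<Phi> f) = counit f) \<and>
     (\<forall>f\<in>QSym. coproduct (\<Phi> f) = tensor_square \<Phi> (coproduct f))}"


section \<open>The associated random walk on permutations\<close>

definition Fcoeff :: "(series \<Rightarrow> series) \<Rightarrow> nat list \<Rightarrow> nat list \<Rightarrow> rat" where
  "Fcoeff \<Phi> \<alpha> \<beta> = fs.representation (F ` Compositions) (\<Phi> (F \<alpha>)) (F \<beta>)"

definition eigen :: "(series \<Rightarrow> series) \<Rightarrow> rat" where
  "eigen \<Phi> = (THE l. \<Phi> (M [1]) = l *\<^sub>f M [1])"

definition D :: "nat \<Rightarrow> (nat \<Rightarrow> nat) \<Rightarrow> nat list" where
  "D n \<sigma> = co n {i. 1 \<le> i \<and> i < n \<and> \<sigma> i > \<sigma> (i + 1)}"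

definition Prob :: "nat \<Rightarrow> (series \<Rightarrow> series) \<Rightarrow> (nat \<Rightarrow> nat) \<Rightarrow> rat" where
  "Prob n \<Phi> \<pi> = Fcoeff \<Phi> (D n \<pi>) (one_part n) /
     (\<Sum>\<sigma>\<in>{\<sigma>. \<sigma> permutes {1..n}}. Fcoeff \<Phi> (D n \<sigma>) (one_part n))"

text \<open>\<open>K(\<pi>, \<sigma>\<pi>) = Prob (\<sigma>\<^sup>-\<^sup>1)\<close>, where \<open>\<sigma>\<close> is recovered from the target \<open>\<tau> = \<sigma>\<pi>\<close> as \<open>\<tau>\<pi>\<^sup>-\<^sup>1\<close>.\<close>

definition K :: "nat \<Rightarrow> (series \<Rightarrow> series) \<Rightarrow> (nat \<Rightarrow> nat) \<Rightarrow> (nat \<Rightarrow> nat) \<Rightarrow> rat" where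
  "K n \<Phi> \<pi> \<tau> = Prob n \<Phi> (inv (\<tau> \<circ> inv \<pi>))"


section \<open>The partitioning property\<close>

definition class_image :: "(series \<Rightarrow> series) \<Rightarrow> nat list set \<Rightarrow> series" where
  "class_image \<Phi> A = \<Phi> (F (SOME \<alpha>. \<alpha> \<in> A))"

text \<open>The equivalence relation \<open>R\<close> witnesses the partitioning property of the restriction of \<open>\<Phi>\<close>
  to \<open>Q n\<close>; the set of classes is \<open>Comp n // R\<close>. Injectivity is needed because the basis is the
  family, not just the set, of the \<open>class_image \<Phi> A\<close>.\<close>

definition partitioning :: "(series \<Rightarrow> series) \<Rightarrow> nat \<Rightarrow> (nat list \<times> nat list) set \<Rightarrow> bool" where
  "partitioning \<Phi> n R \<longleftrightarrow>
     equiv (Comp n) R \<and>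
     (\<forall>(\<alpha>, \<beta>)\<in>R. \<Phi> (F \<alpha>) = \<Phi> (F \<beta>)) \<and>
     inj_on (class_image \<Phi>) (Comp n // R) \<and>
     fs.independent (class_image \<Phi> ` (Comp n // R)) \<and>
     fs.span (class_image \<Phi> ` (Comp n // R)) = \<Phi> ` Q n"

definition dcoeff :: "(series \<Rightarrow> series) \<Rightarrow> nat \<Rightarrow> (nat list \<times> nat list) set \<Rightarrow>
    nat list set \<Rightarrow> nat list set \<Rightarrow> rat" where
  "dcoeff \<Phi> n R A B = fs.representation (class_image \<Phi> ` (Comp n // R))
     (\<Phi> (class_image \<Phi> A)) (class_image \<Phi> B)"

definition Khat :: "(series \<Rightarrow> series) \<Rightarrow> nat \<Rightarrow> (nat list \<times> nat list) set \<Rightarrow>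
    nat list set \<Rightarrow> nat list set \<Rightarrow> rat" where
  "Khat \<Phi> n R A B = dcoeff \<Phi> n R A B / eigen \<Phi> ^ n"

definition stochastic_on :: "'a set \<Rightarrow> ('a \<Rightarrow> 'a \<Rightarrow> rat) \<Rightarrow> bool" where
  "stochastic_on S P \<longleftrightarrow>
     finite S \<and> (\<forall>a\<in>S. \<forall>b\<in>S. 0 \<le> P a b) \<and> (\<forall>a\<in>S. (\<Sum>b\<in>S. P a b) = 1)"

end

theory Submission
  imports Defs "HOL-Library.Product_Lexorder"
begin

text \<open>
  Let \<open>\<psi>\<close> be the character \<open>f \<mapsto> \<Phi> f (x, 0, 0, \<dots>)\<close>; it reads off the coefficient of \<open>F\<^bsub>(n)\<^esub>\<close>, so
  \<open>c\<^bsub>\<alpha>,(n)\<^esub> = \<psi>(F\<^sub>\<alpha>)\<close>. Compatibility with deconcatenation gives the coefficient of \<open>M\<^sub>\<beta>\<close> in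
  \<open>\<Phi>(F\<^bsub>D(\<pi>)\<^esub>)\<close> as the product of the values of \<open>\<psi>\<close> at the consecutive segments of \<open>\<pi>\<close> of lengths
  \<open>b\<^sub>1, \<dots>, b\<^sub>k\<close>. Since \<open>\<psi>\<close> is multiplicative, this is the sum of \<open>\<psi>\<close> over the shuffles of these
  segments, i.e. over the words \<open>\<pi>\<sigma>\<^sup>-\<^sup>1\<close> with \<open>D(\<sigma>) \<le> \<beta>\<close>. Hence
  \<open>\<Phi>(F\<^bsub>D(\<pi>)\<^esub>) = \<Sum>\<^sub>\<sigma> \<psi>(F\<^bsub>D(\<pi>\<sigma>\<^sup>-\<^sup>1)\<^esub>) F\<^bsub>D(\<sigma>)\<^esub>\<close>, in which the coefficients are the unnormalised
  transition probabilities out of \<open>\<pi>\<close>. Applying \<open>\<Phi>\<close> once more and collecting the terms by classes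
  identifies \<open>d\<^bsub>A,B\<^esub>\<close>. The normalising constant is \<open>\<lambda>\<^sup>n\<close>, by the case where all segments have length 1.
\<close>

section \<open>Quasisymmetric functions and their coefficients\<close>

lemma sum_fun_apply: "(\<Sum>i\<in>I. f i) x = (\<Sum>i\<in>I. f i x :: 'b::comm_monoid_add)"
  by (induction I rule: infinite_finite_induct) auto

lemma fscale_apply [simp]: "(c *\<^sub>f f) x = c * f x"
  by (simp add: fscale_def)

section \<open>Monomials and their exponent sequences\<close>

text \<open>The exponents of a monomial, in increasing order of its variables. Each monomial occurs
  in exactly one \<open>M\<close> series, and this composition is its index.\<close>

definition content :: "nat multiset \<Rightarrow> nat list" where
  "content m = map (count m) (sorted_list_of_set (set_mset m))"

text \<open>A representative of the monomials with exponent sequence \<alpha>, using the first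
  variables. Evaluation at it is the functional dual to \<open>M \<alpha>\<close>.\<close>

definition mon :: "nat list \<Rightarrow> nat multiset" where
  "mon \<alpha> = (\<Sum>j<length \<alpha>. replicate_mset (\<alpha> ! j) j)"

lemma sum_list_content: "sum_list (content m) = size m"
proof -
  have "sum_list (content m) = sum (count m) (set_mset m)"
    unfolding content_def by (subst sum_list_distinct_conv_sum_set) auto
  then show ?thesis by (simp add: size_multiset_overloaded_eq)
qed

lemma zero_notin_content: "0 \<notin> set (content m)"
  by (auto simp: content_def image_iff)

lemma content_in_Comp: "content m \<in> Comp (size m)"
  by (simp add: Comp_def sum_list_content zero_notin_content)

text \<open>As no exponent is 0, the variables of a term are exactly the support of the monomial, so
  at most one index sequence exists: the sorted support.\<close>

lemma M_eq:
  assumes "0 \<notin> set \<alpha>"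
  shows "M \<alpha> m = (if \<alpha> = content m then 1 else 0)"
proof -
  define X where "X = {is. length is = length \<alpha> \<and> sorted_wrt (<) is \<and>
    m = (\<Sum>j<length \<alpha>. replicate_mset (\<alpha> ! j) (is ! j))}"
  have *: "\<alpha> = content m \<and> is = sorted_list_of_set (set_mset m)" if "is \<in> X" for "is"
  proof -
    from that have len: "length is = length \<alpha>" and srt: "sorted_wrt (<) is"
      and m: "m = (\<Sum>j<length \<alpha>. replicate_mset (\<alpha> ! j) (is ! j))" by (auto simp: X_def)
    have inj: "is ! i = is ! j \<longleftrightarrow> i = j" if "i < length \<alpha>" "j < length \<alpha>" for i j
      using srt that len by (metis nat_neq_iff order_less_irrefl sorted_wrt_nth_less)
    have cnt: "count m (is ! i) = \<alpha> ! i" if "i < length \<alpha>" for i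
      using that unfolding m by (simp add: count_sum inj)
    have "set_mset m = set is"
    proof (intro set_eqI iffI)
      fix x assume "x \<in># m"
      then have "count m x \<noteq> 0" by simp
      then obtain j where "j < length \<alpha>" "x = is ! j"
        unfolding m count_sum by (auto split: if_splits elim!: sum.not_neutral_contains_not_neutral)
      then show "x \<in> set is" by (simp add: len)
    next
      fix x assume "x \<in> set is"
      then obtain j where j: "j < length \<alpha>" "x = is ! j" by (auto simp: in_set_conv_nth len)
      have "\<alpha> ! j \<in> set \<alpha>" using j by simp
      with assms have "\<alpha> ! j \<noteq> 0" by metis
      with cnt[OF j(1)] j show "x \<in># m" by (metis count_eq_zero_iff)
    qed
    then have is_eq: "is = sorted_list_of_set (set_mset m)"
      using srt by (simp add: sorted_list_of_set.idem_if_sorted_distinct strict_sorted_iff)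
    have "\<alpha> = map (count m) is" by (rule nth_equalityI) (auto simp: len cnt)
    with is_eq show ?thesis by (simp add: content_def)
  qed
  have **: "sorted_list_of_set (set_mset m) \<in> X" if "\<alpha> = content m"
  proof -
    let ?k = "sorted_list_of_set (set_mset m)"
    have len: "length \<alpha> = length ?k" using that by (simp add: content_def)
    have "(\<Sum>j<length \<alpha>. replicate_mset (\<alpha> ! j) (?k ! j))
      = (\<Sum>j<length ?k. replicate_mset (count m (?k ! j)) (?k ! j))"
      by (intro sum.cong) (auto simp: that content_def)
    also have "\<dots> = (\<Sum>x\<in>set_mset m. replicate_mset (count m x) x)"
      using bij_betw_nth[of ?k "{..<length ?k}" "set ?k"]
      by (intro sum.reindex_bij_betw[where g = "\<lambda>x. replicate_mset (count m x) x"]) auto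
    also have "\<dots> = m"
      by (auto simp: multiset_eq_iff count_sum not_in_iff)
    finally show ?thesis
      by (simp add: X_def len)
  qed
  show ?thesis
  proof (cases "\<alpha> = content m")
    case True
    then have "X = {sorted_list_of_set (set_mset m)}" using * ** by blast
    then have "card X = 1" by simp
    with True show ?thesis unfolding M_def X_def by simp
  next
    case False
    then have "X = {}" using * by blast
    then have "card X = 0" by simp
    with False show ?thesis unfolding M_def X_def by simp
  qed
qed

lemma content_mon:
  assumes "0 \<notin> set \<alpha>"
  shows "content (mon \<alpha>) = \<alpha>"
proof -
  let ?X = "{is. length is = length \<alpha> \<and> sorted_wrt (<) is \<and>
    mon \<alpha> = (\<Sum>j<length \<alpha>. replicate_mset (\<alpha> ! j) (is ! j))}"
  have "[0..<length \<alpha>] \<in> ?X" by (auto simp: mon_def)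
  \<comment> \<open>Since \<open>card\<close> of an infinite set is 0, nonemptiness alone would not
    make the coefficient nonzero.\<close>
  moreover have "finite ?X"
  proof (rule finite_subset)
    show "?X \<subseteq> {is. set is \<subseteq> set_mset (mon \<alpha>) \<and> length is = length \<alpha>}"
    proof safe
      fix "is" x assume len: "length is = length \<alpha>" and x: "x \<in> set is"
        and m: "mon \<alpha> = (\<Sum>j<length \<alpha>. replicate_mset (\<alpha> ! j) (is ! j))"
      from x obtain j where j: "j < length \<alpha>" "x = is ! j" by (auto simp: in_set_conv_nth len)
      have "\<alpha> ! j \<in> set \<alpha>" using j by simp
      with assms have "\<alpha> ! j \<noteq> 0" by metis
      with j show "x \<in># mon \<alpha>" unfolding m by (auto simp: set_mset_sum)
    qed
    show "finite {is. set is \<subseteq> set_mset (mon \<alpha>) \<and> length is = length \<alpha>}"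
      by (rule finite_lists_length_eq) simp
  qed
  ultimately have "M \<alpha> (mon \<alpha>) \<noteq> 0" unfolding M_def of_nat_eq_0_iff by (subst card_0_eq) (blast+)
  then show ?thesis using M_eq[OF assms, of "mon \<alpha>"] by (auto split: if_splits)
qed

lemma mon_singleton: "mon [a] = replicate_mset a 0"
  by (simp add: mon_def)

lemma mon_Nil [simp]: "mon [] = {#}"
  by (simp add: mon_def)

lemma mon_one_part: "mon (one_part n) = replicate_mset n 0"
  by (simp add: one_part_def mon_singleton)

lemma one_part_in_Comp: "one_part n \<in> Comp n"
  by (simp add: one_part_def Comp_def)

lemma size_mon: "\<alpha> \<in> Comp n \<Longrightarrow> size (mon \<alpha>) = n"
  using sum_list_content[of "mon \<alpha>"] by (simp add: Comp_def content_mon)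

section \<open>Compositions as sets of cuts\<close>

lemma partial_sums_Nil [simp]: "partial_sums [] = {}"
  by (simp add: partial_sums_def)

lemma partial_sums_singleton [simp]: "partial_sums [a] = {}"
  by (auto simp: partial_sums_def)

lemma partial_sums_Cons:
  assumes "\<alpha> \<noteq> []"
  shows "partial_sums (a # \<alpha>) = insert a ((+) a ` partial_sums \<alpha>)"
proof (intro set_eqI iffI)
  fix s assume "s \<in> partial_sums (a # \<alpha>)"
  then obtain i where i: "s = sum_list (take i (a # \<alpha>))" "1 \<le> i" "i < Suc (length \<alpha>)"
    by (auto simp: partial_sums_def)
  then obtain k where k: "i = Suc k" by (cases i) auto
  show "s \<in> insert a ((+) a ` partial_sums \<alpha>)"
  proof (cases "k = 0")
    case False
    then have "sum_list (take k \<alpha>) \<in> partial_sums \<alpha>"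
      using i k by (auto simp: partial_sums_def)
    then show ?thesis using i k by auto
  qed (use i k in auto)
next
  fix s assume "s \<in> insert a ((+) a ` partial_sums \<alpha>)"
  then consider "s = a" | i where "s = a + sum_list (take i \<alpha>)" "1 \<le> i" "i < length \<alpha>"
    by (auto simp: partial_sums_def)
  then show "s \<in> partial_sums (a # \<alpha>)"
  proof cases
    case 1
    with assms show ?thesis by (auto simp: partial_sums_def intro!: exI[of _ 1])
  next
    case (2 i)
    then show ?thesis unfolding partial_sums_def
      by (intro CollectI exI[of _ "Suc i"]) simp
  qed
qed

lemma partial_sums_bounds:
  assumes "0 \<notin> set \<alpha>" "s \<in> partial_sums \<alpha>"
  shows "0 < s" "s < sum_list \<alpha>"
  using assms
proof (induction \<alpha> arbitrary: s)
  case (Cons a \<alpha>)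
  { case 1 then show ?case using Cons.IH
      by (cases "\<alpha> = []") (auto simp: partial_sums_Cons)
  next
    case 2
    show ?case
    proof (cases "\<alpha> = []")
      case False
      then have "0 < sum_list \<alpha>" using 2(1) by (cases \<alpha>) auto
      with 2 Cons.IH False show ?thesis by (auto simp: partial_sums_Cons)
    qed (use 2 in simp) }
qed simp_all

lemma partial_sums_append:
  assumes "\<alpha> \<noteq> []" "\<beta> \<noteq> []"
  shows "partial_sums (\<alpha> @ \<beta>)
    = partial_sums \<alpha> \<union> {sum_list \<alpha>} \<union> (+) (sum_list \<alpha>) ` partial_sums \<beta>"
  using assms(1)
proof (induction \<alpha>)
  case (Cons a \<alpha>)
  then show ?case using assms(2)
    by (cases "\<alpha> = []") (auto simp: partial_sums_Cons image_Un image_image add.assoc)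
qed simp

text \<open>With two or more parts, the first part is the least partial sum, and peeling it off
  shifts the others by a constant. A single part is fixed by the total.\<close>

lemma partial_sums_inj:
  assumes "0 \<notin> set \<alpha>" "0 \<notin> set \<beta>" "sum_list \<alpha> = sum_list \<beta>"
    "partial_sums \<alpha> = partial_sums \<beta>"
  shows "\<alpha> = \<beta>"
  using assms
proof (induction \<alpha> arbitrary: \<beta>)
  case Nil
  then show ?case by (cases \<beta>) auto
next
  case (Cons a \<alpha>)
  then obtain b \<beta>' where \<beta>: "\<beta> = b # \<beta>'" by (cases \<beta>) auto
  have le: "x \<le> s" if "0 \<notin> set (x # \<gamma>)" "s \<in> partial_sums (x # \<gamma>)" for x s \<gamma>
    using that by (cases "\<gamma> = []") (auto simp: partial_sums_Cons)
  have hd: "x \<in> partial_sums (x # \<gamma>)" if "\<gamma> \<noteq> []" for x \<gamma>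
    using that by (simp add: partial_sums_Cons)
  show ?case
  proof (cases "\<alpha> = []")
    case True
    then have "\<beta>' = []" using Cons.prems hd[of \<beta>' b] by (auto simp: \<beta>)
    with True Cons.prems \<beta> show ?thesis by simp
  next
    case False
    then have \<beta>': "\<beta>' \<noteq> []" using Cons.prems hd[of \<alpha> a] by (auto simp: \<beta>)
    have ab: "a = b"
      using le[of a \<alpha> b] le[of b \<beta>' a] hd[OF False] hd[OF \<beta>'] Cons.prems \<beta>
      by (metis antisym)
    have pos: "a \<notin> (+) a ` partial_sums \<gamma>" if "0 \<notin> set \<gamma>" for \<gamma>
      using partial_sums_bounds(1)[OF that] by force
    have "(+) a ` partial_sums \<alpha> = (+) a ` partial_sums \<beta>'"
      using Cons.prems False \<beta>' ab pos[of \<alpha>] pos[of \<beta>'] \<beta>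
      by (simp add: partial_sums_Cons insert_ident)
    then have "partial_sums \<alpha> = partial_sums \<beta>'" by (simp add: inj_image_eq_iff)
    then have "\<alpha> = \<beta>'" using Cons.IH[of \<beta>'] Cons.prems \<beta> ab by simp
    with ab \<beta> show ?thesis by simp
  qed
qed

lemma inj_on_partial_sums: "inj_on partial_sums (Comp n)"
  by (rule inj_onI, rule partial_sums_inj) (auto simp: Comp_def)

lemma finite_Comp [simp]: "finite (Comp n)"
proof (rule inj_on_finite[OF inj_on_partial_sums])
  show "partial_sums ` Comp n \<subseteq> Pow {..<n}"
    using partial_sums_bounds(2) by (auto simp: Comp_def)
qed simp

definition Des :: "nat \<Rightarrow> (nat \<Rightarrow> nat) \<Rightarrow> nat set" where
  "Des n w = {i. 1 \<le> i \<and> i < n \<and> w i > w (i + 1)}"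

text \<open>Each part \<open>a\<close> becomes a run of \<open>a\<close> equal letters, and the
  letters increase from run to run; the strict ascents of this word are the run boundaries.\<close>

lemma partial_sums_blocks:
  assumes "length \<alpha> = length ks" "sorted_wrt (<) ks" "0 \<notin> set \<alpha>"
  defines "l \<equiv> concat (map2 replicate \<alpha> ks)"
  shows "length l = sum_list \<alpha> \<and> set l = set ks \<and> sorted l \<and>
    partial_sums \<alpha> = {i. 1 \<le> i \<and> i < length l \<and> l ! (i - 1) < l ! i}"
  using assms(1-3) unfolding l_def
proof (induction \<alpha> ks rule: list_induct2)
  case (Cons a \<alpha> x ks)
  define l' where "l' = concat (map2 replicate \<alpha> ks)"
  have IH: "length l' = sum_list \<alpha>" "set l' = set ks" "sorted l'"
    "partial_sums \<alpha> = {i. 1 \<le> i \<and> i < length l' \<and> l' ! (i - 1) < l' ! i}"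
    using Cons.IH Cons.prems by (simp_all add: l'_def)
  let ?l = "replicate a x @ l'"
  have a: "a > 0" using Cons.prems by simp
  have x: "y > x" if "y \<in> set l'" for y using that Cons.prems IH by simp
  have "partial_sums (a # \<alpha>) = {i. 1 \<le> i \<and> i < length ?l \<and> ?l ! (i - 1) < ?l ! i}"
  proof (cases "\<alpha> = []")
    case True
    then show ?thesis using IH by auto
  next
    case False
    then have "sum_list \<alpha> > 0" using Cons.prems by (cases \<alpha>) auto
    then have "length l' > 0" by (simp only: IH)
    then have ne: "l' \<noteq> []" by blast
    have "i \<in> insert a ((+) a ` partial_sums \<alpha>) \<longleftrightarrow>
        1 \<le> i \<and> i < length ?l \<and> ?l ! (i - 1) < ?l ! i" for i
    proof -
      consider "i < a" | "i = a" | i' where "i = a + i'" "i' > 0"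
        by (metis less_imp_add_positive linorder_neqE_nat)
      then show ?thesis
      proof cases
        case 1
        then have "i - 1 < a" by simp
        with 1 have "\<not> ?l ! (i - 1) < ?l ! i" by (simp add: nth_append)
        with 1 show ?thesis by auto
      next
        case 2
        then show ?thesis using a ne x[of "l' ! 0"] by (auto simp: nth_append)
      next
        case (3 i')
        have "a + i' \<in> insert a ((+) a ` partial_sums \<alpha>) \<longleftrightarrow> i' \<in> partial_sums \<alpha>"
          using 3 by auto
        moreover have "?l ! (a + i' - 1) = l' ! (i' - 1)"
          using 3 by (auto simp: nth_append)
        moreover have "?l ! (a + i') = l' ! i'" by (simp add: nth_append)
        ultimately show ?thesis using 3 by (simp add: IH(4))
      qed
    qed
    then show ?thesis by (subst partial_sums_Cons[OF False]) blast
  qed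
  moreover have "sorted ?l"
    using IH x by (auto simp: sorted_append less_imp_le)
  ultimately show ?case using IH a by (simp flip: l'_def)
qed simp

text \<open>The word of runs in \<open>partial_sums_blocks\<close> is the sorted word of
  \<open>m\<close>. Cuts become strict ascents, to be matched with descents later.\<close>

lemma partial_sums_content:
  "partial_sums (content m) =
    {i. 1 \<le> i \<and> i < size m \<and> sorted_list_of_multiset m ! (i - 1) < sorted_list_of_multiset m ! i}"
proof -
  define ks where "ks = sorted_list_of_set (set_mset m)"
  define l where "l = concat (map2 replicate (content m) ks)"
  have *: "length l = size m" "sorted l"
    "partial_sums (content m) = {i. 1 \<le> i \<and> i < length l \<and> l ! (i - 1) < l ! i}"
    using partial_sums_blocks[of "content m" ks] zero_notin_content[of m]
    by (simp_all add: l_def ks_def content_def sum_list_content[unfolded content_def])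
  have "map2 replicate (map (count m) xs) xs = map (\<lambda>x. replicate (count m x) x) xs" for xs
    by (induction xs) auto
  then have l: "l = concat (map (\<lambda>x. replicate (count m x) x) ks)"
    by (simp add: l_def content_def flip: ks_def)
  have "count (mset (concat (map (\<lambda>x. replicate (count m x) x) xs))) y
      = (if y \<in> set xs then count m y else 0)" if "distinct xs" for xs y
    using that by (induction xs) auto
  then have "mset l = m"
    unfolding l by (intro multiset_eqI) (auto simp: ks_def not_in_iff)
  then have "sorted_list_of_multiset m = l"
    using *(2) by (metis sorted_list_of_multiset_mset sorted_sort_id)
  with * show ?thesis by simp
qed

text \<open>The word whose letter at \<open>i\<close> is the number of elements of \<open>S\<close>
  up to \<open>i\<close> ascends exactly at \<open>S\<close>; its content is the required
  composition.\<close>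

lemma ex_composition:
  assumes "S \<subseteq> {1..<n}"
  shows "\<exists>\<alpha>\<in>Comp n. partial_sums \<alpha> = S"
proof -
  define l where "l = map (\<lambda>i. card (S \<inter> {..i})) [0..<n]"
  have mono: "card (S \<inter> {..i}) \<le> card (S \<inter> {..j})" if "i \<le> j" for i j
    using that by (intro card_mono) auto
  have "sorted l"
    unfolding l_def by (auto simp: sorted_iff_nth_mono intro: mono)
  then have "sorted_list_of_multiset (mset l) = l"
    by (simp add: sorted_sort_id)
  moreover have "card (S \<inter> {..i - 1}) < card (S \<inter> {..i}) \<longleftrightarrow> i \<in> S" if "1 \<le> i" for i
  proof -
    have "{..i} = insert i {..i - 1}" using that by auto
    then have "S \<inter> {..i} = (if i \<in> S then insert i (S \<inter> {..i - 1}) else S \<inter> {..i - 1})"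
      by auto
    then show ?thesis using that by (simp add: card_insert_if)
  qed
  ultimately have "partial_sums (content (mset l)) = S"
    using assms by (fastforce simp: partial_sums_content l_def)
  moreover have "content (mset l) \<in> Comp n"
    using content_in_Comp[of "mset l"] by (simp add: l_def)
  ultimately show ?thesis by blast
qed

text \<open>\<open>co\<close> is an \<open>inv_into\<close>, so both facts rest on the surjectivity
  given by \<open>ex_composition\<close>.\<close>

lemma
  shows D_in_Comp: "D n w \<in> Comp n"
    and partial_sums_D: "partial_sums (D n w) = Des n w"
proof -
  have "Des n w \<subseteq> {1..<n}" by (auto simp: Des_def)
  then have "Des n w \<in> partial_sums ` Comp n"
    using ex_composition[of "Des n w" n] by blast
  then show "D n w \<in> Comp n" "partial_sums (D n w) = Des n w"
    unfolding D_def co_def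
    using inv_into_into[of "Des n w" partial_sums "Comp n"]
      f_inv_into_f[of "Des n w" partial_sums "Comp n"]
    by (simp_all add: Des_def)
qed

lemma D_eqI: "\<alpha> \<in> Comp n \<Longrightarrow> Des n w = partial_sums \<alpha> \<Longrightarrow> D n w = \<alpha>"
  using inj_onD[OF inj_on_partial_sums, of "D n w" \<alpha> n] D_in_Comp partial_sums_D by simp

section \<open>Coefficients and dual bases\<close>

lemma F_eq_sum: "\<alpha> \<in> Comp n \<Longrightarrow>
    F \<alpha> = (\<Sum>\<beta>\<in>{\<beta>\<in>Comp n. partial_sums \<alpha> \<subseteq> partial_sums \<beta>}. M \<beta>)"
  unfolding F_def comp_le_def by (intro sum.cong) (auto simp: Comp_def)

text \<open>Only the \<open>M \<beta>\<close> with \<open>\<beta> = content m\<close> can contribute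
  at \<open>m\<close>.\<close>

lemma F_apply:
  assumes "\<alpha> \<in> Comp n"
  shows "F \<alpha> m = (if size m = n \<and> partial_sums \<alpha> \<subseteq> partial_sums (content m) then 1 else 0)"
proof -
  have "F \<alpha> m = (\<Sum>\<beta>\<in>{\<beta>\<in>Comp n. partial_sums \<alpha> \<subseteq> partial_sums \<beta>}. M \<beta> m)"
    by (simp add: F_eq_sum[OF assms] sum_fun_apply)
  also have "\<dots> = (\<Sum>\<beta>\<in>{\<beta>\<in>Comp n. partial_sums \<alpha> \<subseteq> partial_sums \<beta>}.
      if \<beta> = content m then 1 else 0)"
    by (intro sum.cong) (auto simp: M_eq Comp_def)
  also have "\<dots> = (if size m = n \<and> partial_sums \<alpha> \<subseteq> partial_sums (content m) then 1 else 0)"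
    by (auto simp: content_in_Comp) (auto simp: Comp_def sum_list_content)
  finally show ?thesis .
qed

lemma F_D_apply:
  "F (D n w) m = (if size m = n \<and> Des n w \<subseteq> partial_sums (content m) then 1 else 0)"
  using F_apply[OF D_in_Comp] by (simp add: partial_sums_D)

text \<open>
  The bases \<open>M\<close> and \<open>M \<otimes> M\<close> have evaluations at monomials as dual functionals.
\<close>

lemma representation_dual:
  fixes b :: "'i \<Rightarrow> 'a \<Rightarrow> rat"
  assumes dual: "\<And>i j. i \<in> I \<Longrightarrow> j \<in> I \<Longrightarrow> b i (e j) = (if i = j then 1 else 0)"
    and f: "f \<in> fs.span (b ` I)" and j: "j \<in> I"
  shows "fs.representation (b ` I) f (b j) = f (e j)"
proof -
  \<comment> \<open>\<open>representation\<close> refers to the set of basis vectors, not to the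
    family; injectivity links the two.\<close>
  have inj: "inj_on b I"
  proof (rule inj_onI)
    fix i j assume "i \<in> I" "j \<in> I" "b i = b j"
    with dual[of i j] dual[of j j] show "i = j" by (auto split: if_splits)
  qed
  have eval: "(\<Sum>v\<in>T. c v *\<^sub>f v) (e j) = (if b j \<in> T then c (b j) else 0)"
    if "finite T" "T \<subseteq> b ` I" "j \<in> I" for T c j
  proof -
    have "(\<Sum>v\<in>T. c v *\<^sub>f v) (e j) = (\<Sum>v\<in>T. c v * v (e j))"
      by (simp add: sum_fun_apply)
    also have "\<dots> = (\<Sum>v\<in>T. if v = b j then c v else 0)"
    proof (rule sum.cong[OF refl])
      fix v assume "v \<in> T"
      then obtain i where "i \<in> I" "v = b i" using \<open>T \<subseteq> b ` I\<close> by blast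
      then show "c v * v (e j) = (if v = b j then c v else 0)"
        using dual[of i j] that(3) inj by (auto simp: inj_on_eq_iff)
    qed
    finally show ?thesis using that(1) by simp
  qed
  have indep: "fs.independent (b ` I)"
    unfolding fs.dependent_explicit
  proof clarify
    fix T u v assume T: "finite T" "T \<subseteq> b ` I" and z: "(\<Sum>v\<in>T. u v *\<^sub>f v) = 0"
      and v: "v \<in> T" "u v \<noteq> 0"
    obtain j where "j \<in> I" "v = b j" using T v by blast
    with eval[OF T, of j u] z v show False by simp
  qed
  let ?r = "fs.representation (b ` I) f"
  let ?T = "{v. ?r v \<noteq> 0}"
  have "(\<Sum>v\<in>?T. ?r v *\<^sub>f v) = f"
    using fs.sum_nonzero_representation_eq[OF indep f] .
  moreover have "?T \<subseteq> b ` I" using fs.representation_ne_zero by blast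
  ultimately show "?r (b j) = f (e j)"
    using eval[OF fs.finite_representation, of "b ` I" f j ?r] j by (auto split: if_splits)
qed

lemma Comp_no_zero: "\<alpha> \<in> Comp n \<Longrightarrow> 0 \<notin> set \<alpha>"
  by (simp add: Comp_def)

lemma Comp_subset_Compositions: "Comp n \<subseteq> Compositions"
  by (auto simp: Compositions_def)

lemma Compositions_iff: "\<alpha> \<in> Compositions \<longleftrightarrow> 0 \<notin> set \<alpha>"
  by (auto simp: Compositions_def Comp_def)

lemma M_mon: "\<alpha> \<in> Compositions \<Longrightarrow> \<beta> \<in> Compositions \<Longrightarrow> M \<alpha> (mon \<beta>) = (if \<alpha> = \<beta> then 1 else 0)"
  by (simp add: Compositions_iff M_eq content_mon)

lemma Mcoeff_eq:
  assumes "f \<in> QSym" "\<alpha> \<in> Compositions"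
  shows "Mcoeff f \<alpha> = f (mon \<alpha>)"
  using representation_dual[of Compositions M mon f \<alpha>] assms M_mon
  by (simp add: Mcoeff_def QSym_def)

lemma finite_Mcoeff: "finite {\<alpha>\<in>Compositions. Mcoeff f \<alpha> \<noteq> 0}"
proof (rule inj_on_finite)
  show "inj_on M {\<alpha>\<in>Compositions. Mcoeff f \<alpha> \<noteq> 0}"
  proof (rule inj_onI)
    fix \<alpha> \<beta> assume "\<alpha> \<in> {\<alpha>\<in>Compositions. Mcoeff f \<alpha> \<noteq> 0}" "\<beta> \<in> {\<alpha>\<in>Compositions. Mcoeff f \<alpha> \<noteq> 0}"
      "M \<alpha> = M \<beta>"
    with M_mon[of \<alpha> \<beta>] M_mon[of \<beta> \<beta>] show "\<alpha> = \<beta>" by (auto split: if_splits)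
  qed
  show "finite {v. fs.representation (M ` Compositions) f v \<noteq> 0}" by (rule fs.finite_representation)
qed (auto simp: Mcoeff_def)

lemma Q_subset_QSym: "Q n \<subseteq> QSym"
  unfolding Q_def QSym_def by (intro fs.span_mono image_mono Comp_subset_Compositions)

lemma M_in_Q: "\<alpha> \<in> Comp n \<Longrightarrow> M \<alpha> \<in> Q n"
  unfolding Q_def by (intro fs.span_base) auto

lemma F_in_Q: "\<alpha> \<in> Comp n \<Longrightarrow> F \<alpha> \<in> Q n"
  unfolding F_eq_sum unfolding Q_def by (intro fs.span_sum fs.span_base) auto

text \<open>Quasisymmetry: each \<open>M \<alpha>\<close> depends on a monomial only through its
  content.\<close>

lemma QSym_eq_content: "f \<in> QSym \<Longrightarrow> content m = content m' \<Longrightarrow> f m = f m'"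
  unfolding QSym_def
  by (induction rule: fs.span_induct_alt) (auto simp: Compositions_iff M_eq)

lemma Q_eq_zero: "f \<in> Q n \<Longrightarrow> size m \<noteq> n \<Longrightarrow> f m = 0"
  unfolding Q_def
  by (induction rule: fs.span_induct_alt) (auto simp: Comp_def M_eq sum_list_content split: if_splits)

text \<open>In degree \<open>n\<close> the value at a monomial equals the value at the
  representative of its content; in other degrees both sides vanish.\<close>

lemma Q_expand:
  assumes "f \<in> Q n"
  shows "f = (\<Sum>\<alpha>\<in>Comp n. f (mon \<alpha>) *\<^sub>f M \<alpha>)"
proof
  fix m
  have "(\<Sum>\<alpha>\<in>Comp n. f (mon \<alpha>) *\<^sub>f M \<alpha>) m = (\<Sum>\<alpha>\<in>Comp n. if \<alpha> = content m then f (mon \<alpha>) else 0)"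
    unfolding sum_fun_apply by (intro sum.cong) (auto simp: M_eq Comp_def)
  also have "\<dots> = (if content m \<in> Comp n then f (mon (content m)) else 0)"
    by simp
  also have "\<dots> = f m"
  proof (cases "size m = n")
    case True
    moreover have "f (mon (content m)) = f m"
      using assms Q_subset_QSym by (intro QSym_eq_content) (auto simp: content_mon zero_notin_content)
    ultimately show ?thesis using content_in_Comp[of m] by simp
  next
    case False
    then show ?thesis using Q_eq_zero[OF assms False] by (simp add: Comp_def sum_list_content)
  qed
  finally show "f m = (\<Sum>\<alpha>\<in>Comp n. f (mon \<alpha>) *\<^sub>f M \<alpha>) m" ..
qed

lemma Q_eqI: "f \<in> Q n \<Longrightarrow> g \<in> Q n \<Longrightarrow> (\<And>\<alpha>. \<alpha> \<in> Comp n \<Longrightarrow> f (mon \<alpha>) = g (mon \<alpha>)) \<Longrightarrow> f = g"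
  using Q_expand[of f n] Q_expand[of g n] by (metis (no_types, lifting) sum.cong)

section \<open>Coproduct and product on coefficients\<close>

text \<open>The pair of monomials determines both the composition to be cut,
  \<open>content u @ content v\<close>, and the place of the cut.\<close>

lemma coproduct_apply:
  assumes "f \<in> QSym"
  shows "coproduct f (u, v) = Mcoeff f (content u @ content v)"
proof -
  let ?S = "{\<alpha>\<in>Compositions. Mcoeff f \<alpha> \<noteq> 0}"
  let ?\<gamma> = "content u @ content v"
  have *: "(\<Sum>i\<le>length \<alpha>. M (take i \<alpha>) \<otimes> M (drop i \<alpha>)) (u, v) = (if \<alpha> = ?\<gamma> then 1 else 0)"
    if "\<alpha> \<in> Compositions" for \<alpha>
  proof -
    have "(\<Sum>i\<le>length \<alpha>. M (take i \<alpha>) \<otimes> M (drop i \<alpha>)) (u, v)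
      = (\<Sum>i\<le>length \<alpha>. if i = length (content u) then if \<alpha> = ?\<gamma> then 1 else 0 else 0)"
      unfolding sum_fun_apply
    proof (rule sum.cong[OF refl])
      fix i assume i: "i \<in> {..length \<alpha>}"
      have "0 \<notin> set (take i \<alpha>)" "0 \<notin> set (drop i \<alpha>)"
        using that by (auto simp: Compositions_iff dest: in_set_takeD in_set_dropD)
      then have "(M (take i \<alpha>) \<otimes> M (drop i \<alpha>)) (u, v)
          = (if take i \<alpha> = content u \<and> drop i \<alpha> = content v then 1 else 0)"
        by (simp add: tensor_def M_eq)
      also have "take i \<alpha> = content u \<and> drop i \<alpha> = content v \<longleftrightarrow> i = length (content u) \<and> \<alpha> = ?\<gamma>"
        (is "?L \<longleftrightarrow> ?R")
      proof (rule iffI)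
        assume L: ?L
        then have "\<alpha> = ?\<gamma>" by (metis append_take_drop_id)
        moreover have "i = length (take i \<alpha>)" using i by simp
        ultimately show ?R using L by argo
      qed simp
      finally show "(M (take i \<alpha>) \<otimes> M (drop i \<alpha>)) (u, v)
        = (if i = length (content u) then if \<alpha> = ?\<gamma> then 1 else 0 else 0)" by simp
    qed
    then show ?thesis by simp
  qed
  have "coproduct f (u, v)
    = (\<Sum>\<alpha>\<in>?S. Mcoeff f \<alpha> * (\<Sum>i\<le>length \<alpha>. M (take i \<alpha>) \<otimes> M (drop i \<alpha>)) (u, v))"
    by (simp add: coproduct_def sum_fun_apply)
  also have "\<dots> = (\<Sum>\<alpha>\<in>?S. if \<alpha> = ?\<gamma> then Mcoeff f \<alpha> else 0)"
  proof (rule sum.cong[OF refl])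
    fix \<alpha> assume "\<alpha> \<in> ?S"
    then have "\<alpha> \<in> Compositions" by simp
    then show "Mcoeff f \<alpha> * (\<Sum>i\<le>length \<alpha>. M (take i \<alpha>) \<otimes> M (drop i \<alpha>)) (u, v)
        = (if \<alpha> = ?\<gamma> then Mcoeff f \<alpha> else 0)"
      unfolding *[OF \<open>\<alpha> \<in> Compositions\<close>] by simp
  qed
  also have "\<dots> = Mcoeff f ?\<gamma>"
    using finite_Mcoeff[of f] by (auto simp: Compositions_iff zero_notin_content)
  finally show ?thesis .
qed

lemma MMcoeff_eq:
  assumes "t \<in> fs.span {M \<gamma> \<otimes> M \<delta> | \<gamma> \<delta>. \<gamma> \<in> Compositions \<and> \<delta> \<in> Compositions}"
    and "\<alpha> \<in> Compositions" "\<beta> \<in> Compositions"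
  shows "MMcoeff t \<alpha> \<beta> = t (mon \<alpha>, mon \<beta>)"
proof -
  let ?b = "\<lambda>(\<gamma>, \<delta>). M \<gamma> \<otimes> M \<delta>"
  have B: "{M \<gamma> \<otimes> M \<delta> | \<gamma> \<delta>. \<gamma> \<in> Compositions \<and> \<delta> \<in> Compositions}
    = ?b ` (Compositions \<times> Compositions)"
    by auto
  have dual: "?b i ((\<lambda>(\<alpha>, \<beta>). (mon \<alpha>, mon \<beta>)) j) = (if i = j then 1 else 0)"
    if "i \<in> Compositions \<times> Compositions" "j \<in> Compositions \<times> Compositions" for i j
    using that by (auto simp: tensor_def M_mon split: if_splits)
  have "fs.representation (?b ` (Compositions \<times> Compositions)) t (?b (\<alpha>, \<beta>))
      = t ((\<lambda>(\<alpha>, \<beta>). (mon \<alpha>, mon \<beta>)) (\<alpha>, \<beta>))"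
    by (rule representation_dual[where I = "Compositions \<times> Compositions" and j = "(\<alpha>, \<beta>)"
          and e = "\<lambda>(\<alpha>, \<beta>). (mon \<alpha>, mon \<beta>)", OF dual]) (use assms B in auto)
  then show ?thesis by (simp add: MMcoeff_def B)
qed

lemma MMcoeff_coproduct:
  assumes f: "f \<in> QSym" and "\<alpha> \<in> Compositions" "\<beta> \<in> Compositions"
  shows "MMcoeff (coproduct f) \<alpha> \<beta> = Mcoeff f (\<alpha> @ \<beta>)"
proof -
  have "coproduct f \<in> fs.span {M \<gamma> \<otimes> M \<delta> | \<gamma> \<delta>. \<gamma> \<in> Compositions \<and> \<delta> \<in> Compositions}"
    unfolding coproduct_def
    by (intro fs.span_sum fs.span_scale fs.span_base)
      (auto simp: Compositions_iff dest: in_set_takeD in_set_dropD)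
  from MMcoeff_eq[OF this assms(2,3)] show ?thesis
    using assms by (simp add: coproduct_apply content_mon Compositions_iff)
qed

text \<open>\<open>series_mult\<close> sums over this set, and a sum over an infinite set would be 0
  by default.\<close>

lemma finite_mset_splits: "finite {(u, v). u + v = (m :: 'a multiset)}"
proof -
  let ?A = "mset ` {l. set l \<subseteq> set_mset m \<and> length l \<le> size m}"
  have *: "u \<in> ?A" if "u \<subseteq># m" for u
  proof -
    obtain l where "mset l = u" using ex_mset by blast
    with that show ?thesis
      by (intro image_eqI[of _ _ l]) (auto simp: size_mset_mono dest: mset_subset_eqD simp flip: size_mset)
  qed
  have "{(u, v). u + v = m} \<subseteq> ?A \<times> ?A"
    using * mset_subset_eq_add_left mset_subset_eq_add_right by blast
  moreover have "finite (?A \<times> ?A)"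
    by (intro finite_cartesian_product finite_imageI finite_lists_length_le) auto
  ultimately show ?thesis by (rule finite_subset)
qed

text \<open>Setting all variables but the first to 0 is multiplicative: only powers of the first
  variable divide such a power, and homogeneity fixes their degrees. This makes the functional
  \<psi> of the overview a character.\<close>

lemma series_mult_replicate:
  assumes "f \<in> Q p" "g \<in> Q q"
  shows "(f \<odot> g) (replicate_mset (p + q) 0) = f (replicate_mset p 0) * g (replicate_mset q 0)"
proof -
  let ?S = "{(u, v). u + v = replicate_mset (p + q) (0::nat)}"
  let ?x = "(replicate_mset p (0::nat), replicate_mset q (0::nat))"
  have zero: "f u * g v = 0" if "(u, v) \<in> ?S - {?x}" for u v
  proof (rule ccontr)
    assume "f u * g v \<noteq> 0"
    with Q_eq_zero assms have sz: "size u = p" "size v = q" by auto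
    have "set_mset (u + v) \<subseteq> {0}" using that by (auto split: if_splits)
    then have "u = replicate_mset (size u) 0" "v = replicate_mset (size v) 0"
      by (auto simp flip: set_mset_subset_singletonD)
    with sz that show False by auto
  qed
  moreover have "finite ?S"
    by (rule finite_mset_splits)
  moreover have "(case x of (u, v) \<Rightarrow> f u * g v) = 0" if "x \<in> ?S - {?x}" for x
    using that by (cases x) (simp only: case_prod_conv zero)
  moreover have "?x \<in> ?S" by (simp add: multiset_eq_iff)
  ultimately have "(\<Sum>(u, v)\<in>?S. f u * g v) = (\<Sum>(u, v)\<in>{?x}. f u * g v)"
    by (intro sum.mono_neutral_right ballI) blast+
  then show ?thesis by (simp add: series_mult_def)
qed

section \<open>Sorting and shuffles\<close>

text \<open>For an injective key this is its standardisation, the position of \<open>i\<close> after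
  sorting. It is the identity outside {1..n}, as \<open>permutes\<close> demands.\<close>

definition rank :: "nat \<Rightarrow> (nat \<Rightarrow> 'k::linorder) \<Rightarrow> nat \<Rightarrow> nat" where
  "rank n key i = (if i \<in> {1..n} then card {j\<in>{1..n}. key j \<le> key i} else i)"

lemma rank_less_iff:
  assumes "i \<in> {1..n}" "j \<in> {1..n}"
  shows "rank n key i < rank n key j \<longleftrightarrow> key i < key j"
proof
  assume "key i < key j"
  then have "{k\<in>{1..n}. key k \<le> key i} \<subseteq> {k\<in>{1..n}. key k \<le> key j}"
    "j \<in> {k\<in>{1..n}. key k \<le> key j}" "j \<notin> {k\<in>{1..n}. key k \<le> key i}"
    using assms by auto
  then have "{k\<in>{1..n}. key k \<le> key i} \<subset> {k\<in>{1..n}. key k \<le> key j}" by blast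
  then show "rank n key i < rank n key j"
    using assms by (simp add: rank_def psubset_card_mono)
next
  assume *: "rank n key i < rank n key j"
  show "key i < key j"
  proof (rule ccontr)
    assume "\<not> key i < key j"
    then have "{k\<in>{1..n}. key k \<le> key j} \<subseteq> {k\<in>{1..n}. key k \<le> key i}" by auto
    then have "rank n key j \<le> rank n key i" using assms by (simp add: rank_def card_mono)
    with * show False by simp
  qed
qed

lemma rank_permutes:
  assumes "inj_on key {1..n}"
  shows "rank n key permutes {1..n}"
proof (rule bij_imp_permutes)
  have "inj_on (rank n key) {1..n}"
  proof (rule inj_onI)
    fix i j assume ij: "i \<in> {1..n}" "j \<in> {1..n}" "rank n key i = rank n key j"
    then have "key i = key j"
      using rank_less_iff[of i n j key] rank_less_iff[of j n i key] by auto
    with ij assms show "i = j" by (auto dest: inj_onD)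
  qed
  moreover have "rank n key ` {1..n} \<subseteq> {1..n}"
  proof clarify
    fix i assume i: "i \<in> {1..n}"
    have "card {j\<in>{1..n}. key j \<le> key i} \<le> card {1..n}" by (intro card_mono) auto
    moreover have "card {j\<in>{1..n}. key j \<le> key i} \<noteq> 0" using i by auto
    ultimately have "1 \<le> rank n key i" "rank n key i \<le> n"
      using i by (simp_all add: rank_def del: card_eq_0_iff card_0_eq)
    then show "rank n key i \<in> {1..n}" by simp
  qed
  ultimately show "bij_betw (rank n key) {1..n} {1..n}"
    by (simp add: bij_betw_def endo_inj_surj)
qed (auto simp: rank_def)

lemma chain_less:
  fixes h :: "nat \<Rightarrow> 'k::linorder"
  assumes "\<And>p. 1 \<le> p \<Longrightarrow> p < n \<Longrightarrow> h p < h (p + 1)" "1 \<le> p" "p < q" "q \<le> n"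
  shows "h p < h q"
  using assms(3,4)
proof (induction q)
  case (Suc q)
  with assms(1)[of q] \<open>1 \<le> p\<close> show ?case
    by (cases "p = q") (auto intro: less_trans)
qed simp

text \<open>\<open>inv \<sigma>\<close> lists the positions by increasing key, so those with key at
  most \<open>key i\<close> are the first \<open>\<sigma> i\<close> entries of that list.\<close>

lemma rank_unique:
  fixes key :: "nat \<Rightarrow> 'k::linorder"
  assumes \<sigma>: "\<sigma> permutes {1..n}"
    and inc: "\<And>p. 1 \<le> p \<Longrightarrow> p < n \<Longrightarrow> key (inv \<sigma> p) < key (inv \<sigma> (p + 1))"
  shows "\<sigma> = rank n key"
proof
  fix i
  show "\<sigma> i = rank n key i"
  proof (cases "i \<in> {1..n}")
    case True
    have less: "key (inv \<sigma> p) < key (inv \<sigma> q)" if "1 \<le> p" "p < q" "q \<le> n" for p q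
      using chain_less[of n "\<lambda>p. key (inv \<sigma> p)"] inc that by blast
    have \<sigma>i: "\<sigma> j \<in> {1..n}" if "j \<in> {1..n}" for j using permutes_in_image[OF \<sigma>] that by blast
    have le: "key j \<le> key i \<longleftrightarrow> \<sigma> j \<le> \<sigma> i" if "j \<in> {1..n}" for j
      using injD[OF permutes_inj[OF \<sigma>], of i j] less[of "\<sigma> j" "\<sigma> i"] less[of "\<sigma> i" "\<sigma> j"] \<sigma>i[OF that] \<sigma>i[OF True]
        permutes_inverses(2)[OF \<sigma>]
      by (cases "\<sigma> i" "\<sigma> j" rule: linorder_cases) auto
    have "{j\<in>{1..n}. key j \<le> key i} = inv \<sigma> ` {1..\<sigma> i}"
    proof (intro set_eqI iffI)
      fix j assume "j \<in> {j\<in>{1..n}. key j \<le> key i}"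
      then show "j \<in> inv \<sigma> ` {1..\<sigma> i}"
        using le[of j] \<sigma>i[of j] permutes_inverses(2)[OF \<sigma>, of j] by force
    next
      fix j assume "j \<in> inv \<sigma> ` {1..\<sigma> i}"
      then obtain p where p: "j = inv \<sigma> p" "1 \<le> p" "p \<le> \<sigma> i" by auto
      then have "p \<in> {1..n}" using \<sigma>i[OF True] by auto
      then have "j \<in> {1..n}" using p permutes_in_image[OF permutes_inv[OF \<sigma>]] by blast
      then show "j \<in> {j\<in>{1..n}. key j \<le> key i}"
        using le[of j] p permutes_inverses(1)[OF \<sigma>] by simp
    qed
    then have "card {j\<in>{1..n}. key j \<le> key i} = \<sigma> i"
      using permutes_inj_on[OF permutes_inv[OF \<sigma>]] by (simp add: card_image)
    with True show ?thesis by (simp add: rank_def)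
  next
    case False
    then show ?thesis using \<sigma> by (auto simp: rank_def permutes_not_in)
  qed
qed

text \<open>
  The functions on which the standardisation of \<open>f\<close>, with ties broken by \<open>w\<close>, is increasing on the
  segments cut out by \<open>S\<close>. With the generating function \<open>H n S w\<close> below, the product of the
  fundamental quasisymmetric functions of the segments becomes a count.
\<close>

definition lexfuns :: "nat \<Rightarrow> nat set \<Rightarrow> (nat \<Rightarrow> nat) \<Rightarrow> nat multiset \<Rightarrow> (nat \<Rightarrow> nat) set" where
  "lexfuns n S w m = {f \<in> {1..n} \<rightarrow>\<^sub>E UNIV. image_mset f (mset_set {1..n}) = m \<and>
     (\<forall>i. 1 \<le> i \<and> i < n \<and> i \<notin> S \<longrightarrow> (f i, w i) < (f (i + 1), w (i + 1)))}"

definition H :: "nat \<Rightarrow> nat set \<Rightarrow> (nat \<Rightarrow> nat) \<Rightarrow> series" where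
  "H n S w = (\<lambda>m. of_nat (card (lexfuns n S w m)))"

lemma finite_lexfuns: "finite (lexfuns n S w m)"
proof (rule finite_subset)
  show "lexfuns n S w m \<subseteq> {1..n} \<rightarrow>\<^sub>E set_mset m"
    by (auto simp: lexfuns_def PiE_iff extensional_def)
qed (auto intro!: finite_PiE)

section \<open>Products of fundamental series as sums over shuffles\<close>

text \<open>The P-partition argument for a union of chains: sorting the pairs
  \<open>(f i, w i)\<close> yields a permutation \<sigma> and a function
  \<open>g = f \<circ> inv \<sigma>\<close> that is sorted with ties broken by
  \<open>w \<circ> inv \<sigma>\<close>. Being increasing on the segments of \<open>S\<close>
  becomes the condition that \<sigma> has no descent outside \<open>S\<close>.\<close>

lemma card_lexfuns_sort:
  assumes w: "inj_on w {1..n}"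
  shows "card (lexfuns n S w m) =
    (\<Sum>\<sigma>\<in>{\<sigma>. \<sigma> permutes {1..n} \<and> Des n \<sigma> \<subseteq> S}. card (lexfuns n {} (w \<circ> inv \<sigma>) m))"
proof -
  let ?P = "{\<sigma>. \<sigma> permutes {1..n} \<and> Des n \<sigma> \<subseteq> S}"
  let ?L = "\<lambda>\<sigma>. lexfuns n {} (w \<circ> inv \<sigma>) m"
  have mset_comp: "image_mset (f \<circ> \<sigma>) (mset_set {1..n}) = image_mset f (mset_set {1..n})"
    if "\<sigma> permutes {1..n}" for f :: "nat \<Rightarrow> nat" and \<sigma>
  proof -
    have "image_mset \<sigma> (mset_set {1..n}) = mset_set {1..n}"
      using that by (simp add: image_mset_mset_set permutes_inj_on permutes_image)
    then show ?thesis by (simp flip: multiset.map_comp)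
  qed
  have ext: "f \<circ> \<sigma> \<in> {1..n} \<rightarrow>\<^sub>E UNIV" if "\<sigma> permutes {1..n}" "f \<in> {1..n} \<rightarrow>\<^sub>E UNIV"
    for f :: "nat \<Rightarrow> nat" and \<sigma>
    using that by (auto simp: PiE_iff extensional_def permutes_not_in)
  \<comment> \<open>This recovers \<sigma> from \<open>g \<circ> \<sigma>\<close> alone, which gives
    injectivity of the correspondence.\<close>
  have sorted: "\<sigma> = rank n (\<lambda>i. (g (\<sigma> i), w i))" if "\<sigma> permutes {1..n}" "g \<in> ?L \<sigma>" for \<sigma> g
    using that by (intro rank_unique) (auto simp: lexfuns_def permutes_inverses)
  have "bij_betw (\<lambda>(\<sigma>, g). g \<circ> \<sigma>) (Sigma ?P ?L) (lexfuns n S w m)"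
  proof (rule bij_betwI')
    fix x y assume "x \<in> Sigma ?P ?L" "y \<in> Sigma ?P ?L"
    then obtain \<sigma> g \<sigma>' g' where xy: "x = (\<sigma>, g)" "y = (\<sigma>', g')" "\<sigma> \<in> ?P" "\<sigma>' \<in> ?P" "g \<in> ?L \<sigma>" "g' \<in> ?L \<sigma>'"
      by blast
    have "\<sigma> = \<sigma>' \<and> g = g'" if "g \<circ> \<sigma> = g' \<circ> \<sigma>'"
    proof -
      have "g (\<sigma> i) = g' (\<sigma>' i)" for i using fun_cong[OF that, of i] by simp
      then have \<sigma>: "\<sigma> = \<sigma>'" using sorted[of \<sigma> g] sorted[of \<sigma>' g'] xy by simp
      moreover have "g \<circ> \<sigma> \<circ> inv \<sigma> = g' \<circ> \<sigma> \<circ> inv \<sigma>" using that \<sigma> by simp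
      then have "g = g'" using xy permutes_inv_o(1)[of \<sigma> "{1..n}"] by (simp add: o_assoc[symmetric])
      ultimately show ?thesis by simp
    qed
    then show "((case x of (\<sigma>, g) \<Rightarrow> g \<circ> \<sigma>) = (case y of (\<sigma>, g) \<Rightarrow> g \<circ> \<sigma>)) = (x = y)"
      using xy by auto
  next
    fix x assume "x \<in> Sigma ?P ?L"
    then obtain \<sigma> g where x: "x = (\<sigma>, g)" "\<sigma> permutes {1..n}" "Des n \<sigma> \<subseteq> S" "g \<in> ?L \<sigma>"
      by blast
    have "((g \<circ> \<sigma>) i, w i) < ((g \<circ> \<sigma>) (i + 1), w (i + 1))" if i: "1 \<le> i" "i < n" "i \<notin> S" for i
    proof -
      have "\<sigma> i \<noteq> \<sigma> (i + 1)" using permutes_inj[OF x(2)] by (simp add: inj_eq)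
      then have "\<sigma> i < \<sigma> (i + 1)" using i x(3) by (auto simp: Des_def)
      moreover have "\<sigma> i \<in> {1..n}" "\<sigma> (i + 1) \<in> {1..n}"
        using i permutes_in_image[OF x(2)] by auto
      ultimately have "(g (\<sigma> i), w (inv \<sigma> (\<sigma> i))) < (g (\<sigma> (i + 1)), w (inv \<sigma> (\<sigma> (i + 1))))"
        using chain_less[of n "\<lambda>p. (g p, w (inv \<sigma> p))" "\<sigma> i" "\<sigma> (i + 1)"] x(4)
        by (auto simp: lexfuns_def)
      then show ?thesis by (simp add: permutes_inverses[OF x(2)])
    qed
    moreover have "image_mset (g \<circ> \<sigma>) (mset_set {1..n}) = m"
      unfolding mset_comp[OF x(2)] using x(4) unfolding lexfuns_def by blast
    moreover have "g \<circ> \<sigma> \<in> {1..n} \<rightarrow>\<^sub>E UNIV"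
      using x(4) by (intro ext[OF x(2)]) (simp add: lexfuns_def)
    ultimately have "g \<circ> \<sigma> \<in> lexfuns n S w m"
      unfolding lexfuns_def by blast
    then show "(case x of (\<sigma>, g) \<Rightarrow> g \<circ> \<sigma>) \<in> lexfuns n S w m"
      by (simp only: x(1) case_prod_conv)
  next
    fix f assume f: "f \<in> lexfuns n S w m"
    define key where "key = (\<lambda>i. (f i, w i))"
    define \<sigma> where "\<sigma> = rank n key"
    have "inj_on key {1..n}"
    proof (rule inj_onI)
      fix i j assume ij: "i \<in> {1..n}" "j \<in> {1..n}" "key i = key j"
      then have "w i = w j" by (simp add: key_def)
      with ij inj_onD[OF w] show "i = j" by blast
    qed
    then have \<sigma>: "\<sigma> permutes {1..n}"
      unfolding \<sigma>_def by (rule rank_permutes)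
    have "Des n \<sigma> \<subseteq> S"
    proof
      fix i assume "i \<in> Des n \<sigma>"
      then have i: "1 \<le> i" "i < n" "\<not> \<sigma> i < \<sigma> (i + 1)" by (auto simp: Des_def)
      then have "\<not> key i < key (i + 1)" unfolding \<sigma>_def by (subst (asm) rank_less_iff) auto
      with f i show "i \<in> S" by (auto simp: lexfuns_def key_def)
    qed
    moreover have "(f (inv \<sigma> p), w (inv \<sigma> p)) < (f (inv \<sigma> (p + 1)), w (inv \<sigma> (p + 1)))"
      if "1 \<le> p" "p < n" for p
    proof -
      have "inv \<sigma> p \<in> {1..n}" "inv \<sigma> (p + 1) \<in> {1..n}"
        using that permutes_in_image[OF permutes_inv[OF \<sigma>]] by auto
      from rank_less_iff[OF this, of key, folded \<sigma>_def] show ?thesis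
        by (simp add: permutes_inverses[OF \<sigma>] key_def)
    qed
    moreover have "f \<circ> inv \<sigma> \<in> {1..n} \<rightarrow>\<^sub>E UNIV"
      using f by (intro ext[OF permutes_inv[OF \<sigma>]]) (simp add: lexfuns_def)
    moreover have "image_mset (f \<circ> inv \<sigma>) (mset_set {1..n}) = m"
      unfolding mset_comp[OF permutes_inv[OF \<sigma>]] using f unfolding lexfuns_def by blast
    ultimately have "f \<circ> inv \<sigma> \<in> ?L \<sigma>" "Des n \<sigma> \<subseteq> S"
      unfolding lexfuns_def by auto
    moreover have "f \<circ> inv \<sigma> \<circ> \<sigma> = f"
      using permutes_inv_o(2)[OF \<sigma>] by (simp add: o_assoc[symmetric])
    ultimately show "\<exists>x\<in>Sigma ?P ?L. f = (case x of (\<sigma>, g) \<Rightarrow> g \<circ> \<sigma>)"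
      using \<sigma> by (intro bexI[of _ "(\<sigma>, f \<circ> inv \<sigma>)"]) auto
  qed
  then have "card (lexfuns n S w m) = card (Sigma ?P ?L)" by (simp add: bij_betw_same_card)
  also have "\<dots> = (\<Sum>\<sigma>\<in>?P. card (?L \<sigma>))"
    by (rule card_SigmaI) (auto simp: finite_lexfuns intro: finite_subset[OF _ finite_permutations[of "{1..n}"]])
  finally show ?thesis .
qed

text \<open>Without cuts, \<open>f\<close> must be weakly increasing, hence the sorted word of
  \<open>m\<close>. The tie-break by \<open>v\<close> makes it strict exactly at the descents of
  \<open>v\<close>, which is the condition for \<open>m\<close> to occur in the fundamental
  series.\<close>

lemma H_empty:
  assumes v: "inj_on v {1..n}"
  shows "H n {} v = F (D n v)"
proof
  fix m
  let ?L = "lexfuns n {} v m"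
  define l where "l = sorted_list_of_multiset m"
  \<comment> \<open>Positions start at 1 here and at 0 in \<open>l\<close>; \<open>restrict\<close>
    makes the function extensional.\<close>
  define f\<^sub>0 where "f\<^sub>0 = restrict (\<lambda>i. l ! (i - 1)) {1..n}"
  have l: "sorted l" "mset l = m" "length l = size m"
    by (auto simp: l_def simp flip: size_mset)
  have step: "(f i, v i) < (f (i + 1), v (i + 1)) \<longleftrightarrow>
      f i \<le> f (i + 1) \<and> (i \<in> Des n v \<longrightarrow> f i < f (i + 1))" if "1 \<le> i" "i < n" for f :: "nat \<Rightarrow> nat" and i
  proof -
    have "v i \<noteq> v (i + 1)" using inj_onD[OF v, of i "i + 1"] that by auto
    with that show ?thesis by (auto simp: Des_def)
  qed
  have size: "size m = n" if "f \<in> ?L" for f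
    using that by (auto simp: lexfuns_def)
  have "f = f\<^sub>0" if f: "f \<in> ?L" for f
  proof
    fix i
    have le: "f p \<le> f q" if "1 \<le> p" "p \<le> q" "q \<le> n" for p q
      using chain_less[of n "\<lambda>p. (f p, v p)" p q] f that
      by (cases "p = q") (auto simp: lexfuns_def)
    have "sorted (map f [1..<n+1])"
      by (auto simp: sorted_iff_nth_mono simp del: upt_Suc intro!: le)
    moreover have "mset (map f [1..<n+1]) = m"
      using f by (simp add: lexfuns_def mset_map mset_upt atLeastLessThanSuc_atLeastAtMost del: upt_Suc)
    ultimately have "map f [1..<n+1] = l"
      using l by (metis l_def sorted_list_of_multiset_mset sorted_sort_id)
    then show "f i = f\<^sub>0 i"
      using f by (auto simp: f\<^sub>0_def lexfuns_def PiE_iff extensional_def simp del: upt_Suc)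
  qed
  moreover have "f\<^sub>0 \<in> ?L \<longleftrightarrow> Des n v \<subseteq> partial_sums (content m)" if n: "size m = n"
  proof -
    have "map f\<^sub>0 [1..<n+1] = l"
      using l n by (intro nth_equalityI) (auto simp: f\<^sub>0_def simp del: upt_Suc)
    then have "mset (map f\<^sub>0 [1..<n+1]) = m" using l by simp
    then have "image_mset f\<^sub>0 (mset_set {1..n}) = m"
      by (simp add: mset_map mset_upt atLeastLessThanSuc_atLeastAtMost del: upt_Suc)
    then have "f\<^sub>0 \<in> ?L \<longleftrightarrow> (\<forall>i. 1 \<le> i \<and> i < n \<longrightarrow>
        f\<^sub>0 i \<le> f\<^sub>0 (i + 1) \<and> (i \<in> Des n v \<longrightarrow> f\<^sub>0 i < f\<^sub>0 (i + 1)))"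
      using step[of _ f\<^sub>0] by (auto simp: lexfuns_def f\<^sub>0_def)
    also have "\<dots> \<longleftrightarrow> (\<forall>i. 1 \<le> i \<and> i < n \<longrightarrow> i \<in> Des n v \<longrightarrow> l ! (i - 1) < l ! i)"
      using l n by (auto simp: f\<^sub>0_def sorted_iff_nth_mono)
    also have "\<dots> \<longleftrightarrow> Des n v \<subseteq> partial_sums (content m)"
      using n by (auto simp: partial_sums_content Des_def l_def)
    finally show ?thesis .
  qed
  ultimately have "?L = (if size m = n \<and> Des n v \<subseteq> partial_sums (content m) then {f\<^sub>0} else {})"
    using size by auto
  then show "H n {} v m = F (D n v) m" by (simp add: H_def F_D_apply)
qed

text \<open>\<open>Des n \<sigma> \<subseteq> S\<close> says that \<sigma> increases on every
  segment, so that \<open>w \<circ> inv \<sigma>\<close> is a shuffle of the segments of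
  \<open>w\<close>.\<close>

lemma H_eq_sum_F:
  assumes w: "inj_on w {1..n}"
  shows "H n S w = (\<Sum>\<sigma>\<in>{\<sigma>. \<sigma> permutes {1..n} \<and> Des n \<sigma> \<subseteq> S}. F (D n (w \<circ> inv \<sigma>)))"
proof
  fix m
  have inj: "inj_on (w \<circ> inv \<sigma>) {1..n}" if "\<sigma> permutes {1..n}" for \<sigma>
    using that w by (intro comp_inj_on) (auto simp: permutes_image permutes_inv intro: permutes_inj_on permutes_inv)
  have "H n S w m = (\<Sum>\<sigma>\<in>{\<sigma>. \<sigma> permutes {1..n} \<and> Des n \<sigma> \<subseteq> S}. H n {} (w \<circ> inv \<sigma>) m)"
    by (simp add: H_def card_lexfuns_sort[OF w, of S])
  also have "\<dots> = (\<Sum>\<sigma>\<in>{\<sigma>. \<sigma> permutes {1..n} \<and> Des n \<sigma> \<subseteq> S}. F (D n (w \<circ> inv \<sigma>)) m)"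
    by (intro sum.cong) (auto simp: H_empty inj simp del: One_nat_def)
  finally show "H n S w m = (\<Sum>\<sigma>\<in>{\<sigma>. \<sigma> permutes {1..n} \<and> Des n \<sigma> \<subseteq> S}. F (D n (w \<circ> inv \<sigma>))) m"
    by (simp add: sum_fun_apply)
qed

text \<open>A function on the positions is a pair of functions on the first \<open>p\<close> and the
  last \<open>q\<close> of them, and its multiset of values is the sum of theirs. The cut at
  \<open>p\<close> removes any condition linking the two.\<close>

lemma series_mult_H:
  "H p {} w \<odot> H q S (\<lambda>i. w (i + p)) = H (p + q) (insert p ((+) p ` S)) w"
proof
  fix m :: "nat multiset"
  let ?w' = "\<lambda>i. w (i + p)" and ?S = "insert p ((+) p ` S)"
  let ?T = "{(u, v). u + v = m}"
  let ?A = "\<lambda>(u, v). lexfuns p {} w u \<times> lexfuns q S ?w' v"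
  let ?l = "\<lambda>f. restrict f {1..p}" and ?r = "\<lambda>f. restrict (\<lambda>i. f (i + p)) {1..q}"
  \<comment> \<open>The target is a disjoint union over the factorisations of \<open>m\<close>, so
    the two multisets are kept as tags; \<open>?from\<close> forgets them.\<close>
  let ?to = "\<lambda>f. ((image_mset (?l f) (mset_set {1..p}), image_mset (?r f) (mset_set {1..q})), (?l f, ?r f))"
  let ?from = "\<lambda>(x :: nat multiset \<times> nat multiset, (g, h)) i.
    if i \<in> {1..p} then g i else if i \<in> {p+1..p+q} then h (i - p) else undefined :: nat"
  have split: "image_mset f (mset_set {1..p+q})
      = image_mset f (mset_set {1..p}) + image_mset (\<lambda>i. f (i + p)) (mset_set {1..q})" for f :: "nat \<Rightarrow> nat"
  proof -
    have "{1..p+q} = {1..p} \<union> (\<lambda>i. i + p) ` {1..q}"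
      by (auto simp: image_iff intro!: bexI[of _ "x - p" for x])
    then have "mset_set {1..p+q} = mset_set {1..p} + mset_set ((\<lambda>i. i + p) ` {1..q})"
      by (simp only:) (rule mset_set_Union, auto)
    also have "mset_set ((\<lambda>i. i + p) ` {1..q}) = image_mset (\<lambda>i. i + p) (mset_set {1..q})"
      by (simp add: image_mset_mset_set)
    finally show ?thesis by (simp add: multiset.map_comp comp_def)
  qed
  have res: "image_mset (restrict f X) (mset_set X) = image_mset f (mset_set X)"
    for f :: "nat \<Rightarrow> nat" and X
    by (cases "finite X") (auto intro: image_mset_cong)
  \<comment> \<open>Positions after the cut are \<open>i + p\<close> with \<open>i\<close> at least
    1; position \<open>p\<close> itself is exempt.\<close>
  have cond: "(\<forall>i. 1 \<le> i \<and> i < p + q \<and> i \<notin> ?S \<longrightarrow> R i) \<longleftrightarrow>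
      (\<forall>i. 1 \<le> i \<and> i < p \<longrightarrow> R i) \<and> (\<forall>i. 1 \<le> i \<and> i < q \<and> i \<notin> S \<longrightarrow> R (i + p))" (is "?L \<longleftrightarrow> ?R") for R
  proof
    assume L: ?L
    have "R i" if "1 \<le> i" "i < p" for i using L that by auto
    moreover have "R (i + p)" if "1 \<le> i" "i < q" "i \<notin> S" for i
      using L[rule_format, of "i + p"] that by (simp add: image_iff add.commute[of _ p])
    ultimately show ?R by blast
  next
    assume R: ?R
    show ?L
    proof (intro allI impI)
      fix i assume i: "1 \<le> i \<and> i < p + q \<and> i \<notin> ?S"
      show "R i"
      proof (cases "i < p")
        case False
        with i have "i > p" by auto
        then obtain j where j: "i = p + j" "j > 0" by (metis less_imp_add_positive)
        with i have "j \<notin> S" "j < q" by auto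
        with j R have "R (j + p)" by auto
        with j show ?thesis by (simp add: add.commute[of p])
      qed (use i R in auto)
    qed
  qed
  have "bij_betw ?to (lexfuns (p + q) ?S w m) (Sigma ?T ?A)"
  proof (rule bij_betw_byWitness[where f' = ?from])
    show "\<forall>f\<in>lexfuns (p + q) ?S w m. ?from (?to f) = f"
      by (auto simp: lexfuns_def fun_eq_iff PiE_iff extensional_def)
    show "\<forall>y\<in>Sigma ?T ?A. ?to (?from y) = y"
    proof
      fix y assume "y \<in> Sigma ?T ?A"
      then obtain u v g h where y: "y = ((u, v), (g, h))"
        and gh: "g \<in> lexfuns p {} w u" "h \<in> lexfuns q S ?w' v" by auto
      let ?f = "?from ((u, v), (g, h))"
      have "?l ?f = g" "?r ?f = h"
        using gh by (auto simp: lexfuns_def fun_eq_iff PiE_iff extensional_def)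
      moreover have "image_mset g (mset_set {1..p}) = u" "image_mset h (mset_set {1..q}) = v"
        using gh by (auto simp: lexfuns_def)
      ultimately have "?to ?f = ((u, v), (g, h))" by simp
      then show "?to (?from y) = y" unfolding y .
    qed
    show "?to ` lexfuns (p + q) ?S w m \<subseteq> Sigma ?T ?A"
    proof (rule image_subsetI)
      fix f assume f: "f \<in> lexfuns (p + q) ?S w m"
      let ?R = "\<lambda>i. (f i, w i) < (f (i + 1), w (i + 1))"
      have "\<forall>i. 1 \<le> i \<and> i < p + q \<and> i \<notin> ?S \<longrightarrow> ?R i" using f by (simp add: lexfuns_def)
      from this[unfolded cond[of ?R]] have "?l f \<in> lexfuns p {} w (image_mset (?l f) (mset_set {1..p}))"
        "?r f \<in> lexfuns q S ?w' (image_mset (?r f) (mset_set {1..q}))"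
        by (auto simp: lexfuns_def)
      moreover have "image_mset (?l f) (mset_set {1..p}) + image_mset (?r f) (mset_set {1..q}) = m"
        using f split[of f] unfolding res lexfuns_def by simp
      ultimately show "?to f \<in> Sigma ?T ?A" by auto
    qed
    show "?from ` Sigma ?T ?A \<subseteq> lexfuns (p + q) ?S w m"
    proof (rule image_subsetI)
      fix y assume "y \<in> Sigma ?T ?A"
      then obtain u v g h where y: "y = ((u, v), (g, h))" and m: "u + v = m"
        and gh: "g \<in> lexfuns p {} w u" "h \<in> lexfuns q S ?w' v" by auto
      let ?f = "?from ((u, v), (g, h))"
      let ?R = "\<lambda>i. (?f i, w i) < (?f (i + 1), w (i + 1))"
      have "?R i" if "1 \<le> i" "i < p" for i using gh(1) that by (auto simp: lexfuns_def)
      moreover have "?R (i + p)" if "1 \<le> i" "i < q" "i \<notin> S" for i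
        using gh(2) that by (auto simp: lexfuns_def)
      ultimately have "\<forall>i. 1 \<le> i \<and> i < p + q \<and> i \<notin> ?S \<longrightarrow> ?R i"
        unfolding cond[of ?R] by blast
      moreover have "image_mset ?f (mset_set {1..p}) = image_mset g (mset_set {1..p})"
        "image_mset (\<lambda>i. ?f (i + p)) (mset_set {1..q}) = image_mset h (mset_set {1..q})"
        by (auto intro!: image_mset_cong)
      then have "image_mset ?f (mset_set {1..p+q}) = u + v"
        using gh split[of ?f] unfolding lexfuns_def by simp
      moreover have "?f \<in> {1..p+q} \<rightarrow>\<^sub>E UNIV" by (auto simp: PiE_iff extensional_def)
      ultimately have "?f \<in> lexfuns (p + q) ?S w m"
        unfolding lexfuns_def m by blast
      then show "?from y \<in> lexfuns (p + q) ?S w m" unfolding y .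
    qed
  qed
  then have "card (lexfuns (p + q) ?S w m) = card (Sigma ?T ?A)" by (rule bij_betw_same_card)
  also have "\<dots> = (\<Sum>x\<in>?T. card (?A x))"
    by (rule card_SigmaI) (auto simp: finite_mset_splits finite_lexfuns)
  also have "\<dots> = (\<Sum>(u, v)\<in>?T. card (lexfuns p {} w u) * card (lexfuns q S ?w' v))"
    by (intro sum.cong) (auto simp: card_cartesian_product)
  finally show "(H p {} w \<odot> H q S ?w') m = H (p + q) ?S w m"
    by (simp add: series_mult_def H_def case_prod_unfold)
qed

section \<open>Endomorphisms\<close>

lemma QSym_EndD:
  assumes "\<Phi> \<in> QSym_End"
  shows "f \<in> QSym \<Longrightarrow> g \<in> QSym \<Longrightarrow> \<Phi> (f + g) = \<Phi> f + \<Phi> g"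
    and "f \<in> QSym \<Longrightarrow> \<Phi> (c *\<^sub>f f) = c *\<^sub>f \<Phi> f"
    and "f \<in> Q n \<Longrightarrow> \<Phi> f \<in> Q n"
    and "\<Phi> series_one = series_one"
    and "f \<in> QSym \<Longrightarrow> g \<in> QSym \<Longrightarrow> \<Phi> (f \<odot> g) = \<Phi> f \<odot> \<Phi> g"
    and "f \<in> QSym \<Longrightarrow> coproduct (\<Phi> f) = tensor_square \<Phi> (coproduct f)"
  using assms unfolding QSym_End_def by blast+

lemma End_sum:
  assumes \<Phi>: "\<Phi> \<in> QSym_End" and f: "\<And>i. i \<in> I \<Longrightarrow> f i \<in> QSym"
  shows "\<Phi> (\<Sum>i\<in>I. c i *\<^sub>f f i) = (\<Sum>i\<in>I. c i *\<^sub>f \<Phi> (f i))"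
proof -
  have z: "\<Phi> 0 = 0"
    using QSym_EndD(2)[OF \<Phi>, of 0 0] by (simp add: QSym_def fs.span_zero)
  show ?thesis using f
  proof (induction I rule: infinite_finite_induct)
    case (insert i I)
    then have "c i *\<^sub>f f i \<in> QSym" "(\<Sum>i\<in>I. c i *\<^sub>f f i) \<in> QSym"
      by (auto simp: QSym_def intro!: fs.span_scale fs.span_sum)
    with insert show ?case by (simp add: QSym_EndD(1,2)[OF \<Phi>] del: fscale_apply plus_fun_apply)
  qed (simp_all add: z)
qed

lemma End_M_apply:
  assumes \<Phi>: "\<Phi> \<in> QSym_End" and "\<alpha> \<in> Compositions" "size m \<noteq> sum_list \<alpha>"
  shows "\<Phi> (M \<alpha>) m = 0"
proof (rule Q_eq_zero)
  have "\<alpha> \<in> Comp (sum_list \<alpha>)" using assms by (simp add: Compositions_iff Comp_def)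
  then show "\<Phi> (M \<alpha>) \<in> Q (sum_list \<alpha>)" by (intro QSym_EndD(3)[OF \<Phi>] M_in_Q)
qed (use assms in simp)

text \<open>A value at a concatenation is a value of the coproduct at a pair of monomials, and the
  coproduct commutes with \<Phi>. Homogeneity leaves only the degrees \<open>p\<close> and
  \<open>q\<close>.\<close>

lemma End_apply_append:
  assumes \<Phi>: "\<Phi> \<in> QSym_End" and f: "f \<in> Q n"
    and \<alpha>: "\<alpha> \<in> Comp p" and \<beta>: "\<beta> \<in> Comp q"
  shows "\<Phi> f (mon (\<alpha> @ \<beta>)) =
    (\<Sum>\<gamma>\<in>Comp p. \<Sum>\<delta>\<in>Comp q. f (mon (\<gamma> @ \<delta>)) * \<Phi> (M \<gamma>) (mon \<alpha>) * \<Phi> (M \<delta>) (mon \<beta>))"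
proof -
  have fQ: "f \<in> QSym" "\<Phi> f \<in> QSym"
    using f QSym_EndD(3)[OF \<Phi> f] Q_subset_QSym by auto
  have nz: "0 \<notin> set \<alpha>" "0 \<notin> set \<beta>" using \<alpha> \<beta> by (auto simp: Comp_def)
  let ?t = "MMcoeff (coproduct f)"
  let ?S = "{(\<gamma>, \<delta>). \<gamma> \<in> Compositions \<and> \<delta> \<in> Compositions \<and> ?t \<gamma> \<delta> \<noteq> 0}"
  let ?h = "\<lambda>(\<gamma>, \<delta>). ?t \<gamma> \<delta> * (\<Phi> (M \<gamma>) (mon \<alpha>) * \<Phi> (M \<delta>) (mon \<beta>))"
  have t: "?t \<gamma> \<delta> = f (mon (\<gamma> @ \<delta>))" if "\<gamma> \<in> Compositions" "\<delta> \<in> Compositions" for \<gamma> \<delta>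
    using that fQ by (simp add: MMcoeff_coproduct Mcoeff_eq Compositions_iff)
  have fin: "finite ?S"
  proof (rule finite_subset)
    let ?X = "{\<alpha>\<in>Compositions. Mcoeff f \<alpha> \<noteq> 0}"
    \<comment> \<open>A pair in \<open>?S\<close> is a cut of some composition in the finite support
      of \<open>f\<close>.\<close>
    show "?S \<subseteq> (\<Union>\<alpha>\<in>?X. (\<lambda>i. (take i \<alpha>, drop i \<alpha>)) ` {..length \<alpha>})"
    proof clarify
      fix \<gamma> \<delta> assume "\<gamma> \<in> Compositions" "\<delta> \<in> Compositions" "?t \<gamma> \<delta> \<noteq> 0"
      then have "\<gamma> @ \<delta> \<in> ?X" using fQ by (simp add: MMcoeff_coproduct Compositions_iff)
      moreover have "(\<gamma>, \<delta>) \<in> (\<lambda>i. (take i (\<gamma> @ \<delta>), drop i (\<gamma> @ \<delta>))) ` {..length (\<gamma> @ \<delta>)}"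
        by (intro image_eqI[of _ _ "length \<gamma>"]) auto
      ultimately show "(\<gamma>, \<delta>) \<in> (\<Union>\<alpha>\<in>?X. (\<lambda>i. (take i \<alpha>, drop i \<alpha>)) ` {..length \<alpha>})" by blast
    qed
    show "finite (\<Union>\<alpha>\<in>?X. (\<lambda>i. (take i \<alpha>, drop i \<alpha>)) ` {..length \<alpha>})"
      using finite_Mcoeff by blast
  qed
  have "\<Phi> f (mon (\<alpha> @ \<beta>)) = coproduct (\<Phi> f) (mon \<alpha>, mon \<beta>)"
    using nz fQ by (simp add: coproduct_apply content_mon Mcoeff_eq Compositions_iff)
  also have "\<dots> = tensor_square \<Phi> (coproduct f) (mon \<alpha>, mon \<beta>)"
    by (simp add: QSym_EndD(6)[OF \<Phi> fQ(1)])
  also have "\<dots> = sum ?h ?S"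
    unfolding tensor_square_def sum_fun_apply
    by (intro sum.cong) (auto simp: tensor_def)
  \<comment> \<open>Neither index set need contain the other: pairs of other degrees vanish because
    \<Phi> is graded, and pairs missing from \<open>?S\<close> have coefficient 0.\<close>
  also have "\<dots> = sum ?h (Comp p \<times> Comp q)"
  proof (rule sum.mono_neutral_cong)
    fix x assume x: "x \<in> ?S - Comp p \<times> Comp q"
    then obtain \<gamma> \<delta> where x': "x = (\<gamma>, \<delta>)" "\<gamma> \<in> Compositions" "\<delta> \<in> Compositions" by blast
    with x have "sum_list \<gamma> \<noteq> p \<or> sum_list \<delta> \<noteq> q" by (auto simp: Compositions_iff Comp_def)
    then show "?h x = 0"
      using End_M_apply[OF \<Phi>, of _ "mon \<alpha>"] End_M_apply[OF \<Phi>, of _ "mon \<beta>"] x'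
      by (auto simp: size_mon[OF \<alpha>] size_mon[OF \<beta>])
  next
    fix x assume "x \<in> Comp p \<times> Comp q - ?S"
    then show "?h x = 0" using Comp_subset_Compositions by auto
  qed (use fin in auto)
  also have "\<dots> = (\<Sum>\<gamma>\<in>Comp p. \<Sum>\<delta>\<in>Comp q. ?h (\<gamma>, \<delta>))"
    by (simp add: sum.cartesian_product)
  also have "\<dots> = (\<Sum>\<gamma>\<in>Comp p. \<Sum>\<delta>\<in>Comp q. f (mon (\<gamma> @ \<delta>)) * \<Phi> (M \<gamma>) (mon \<alpha>) * \<Phi> (M \<delta>) (mon \<beta>))"
    using Comp_subset_Compositions by (intro sum.cong) (auto simp: t subset_eq)
  finally show ?thesis .
qed

lemma End_Q_expand:
  assumes "\<Phi> \<in> QSym_End" "f \<in> Q n"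
  shows "\<Phi> f m = (\<Sum>\<alpha>\<in>Comp n. f (mon \<alpha>) * \<Phi> (M \<alpha>) m)"
proof -
  have "\<Phi> f = \<Phi> (\<Sum>\<alpha>\<in>Comp n. f (mon \<alpha>) *\<^sub>f M \<alpha>)" using Q_expand[OF assms(2)] by simp
  also have "\<dots> = (\<Sum>\<alpha>\<in>Comp n. f (mon \<alpha>) *\<^sub>f \<Phi> (M \<alpha>))"
    using M_in_Q Q_subset_QSym by (intro End_sum assms) blast
  finally show ?thesis by (simp add: sum_fun_apply)
qed

section \<open>Images of the fundamental series\<close>

lemma F_D_in_Q: "F (D n w) \<in> Q n"
  by (rule F_in_Q[OF D_in_Comp])

lemma F_D_mon: "\<beta> \<in> Comp n \<Longrightarrow> F (D n w) (mon \<beta>) = (if Des n w \<subseteq> partial_sums \<beta> then 1 else 0)"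
  by (simp add: F_D_apply size_mon content_mon Comp_no_zero)

text \<open>The bounds on \<open>i\<close> let one formula cover an empty \<gamma> or \<delta>:
  \<open>p\<close> is then 0 or \<open>p + q\<close>, so \<open>i = p\<close> cannot occur.\<close>

lemma partial_sums_append_cases:
  assumes "\<gamma> \<in> Comp p" "\<delta> \<in> Comp q" "0 < i" "i < p + q"
  shows "i \<in> partial_sums (\<gamma> @ \<delta>) \<longleftrightarrow>
    (i < p \<and> i \<in> partial_sums \<gamma>) \<or> i = p \<or> (\<exists>j\<in>partial_sums \<delta>. i = p + j)"
proof -
  have *: "s < p" if "s \<in> partial_sums \<gamma>" for s
    using that assms partial_sums_bounds[of \<gamma>] by (auto simp: Comp_def)
  consider "\<gamma> = []" | "\<delta> = []" | "\<gamma> \<noteq> []" "\<delta> \<noteq> []" by blast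
  then show ?thesis
  proof cases
    case 1 with assms show ?thesis by (auto simp: Comp_def)
  next
    case 2 with assms show ?thesis by (auto simp: Comp_def dest: *)
  next
    case 3
    with assms show ?thesis by (auto simp: partial_sums_append Comp_def dest: *)
  qed
qed

text \<open>A descent at \<open>p\<close> is absorbed by the cut between \<gamma> and \<delta>; any
  other descent lies inside the prefix or the suffix of \<open>w\<close>.\<close>

lemma F_D_mon_append:
  assumes "\<gamma> \<in> Comp p" "\<delta> \<in> Comp q"
  shows "F (D (p + q) w) (mon (\<gamma> @ \<delta>)) = F (D p w) (mon \<gamma>) * F (D q (\<lambda>i. w (i + p))) (mon \<delta>)"
proof -
  have c: "\<gamma> @ \<delta> \<in> Comp (p + q)" using assms by (auto simp: Comp_def)
  have "Des (p + q) w \<subseteq> partial_sums (\<gamma> @ \<delta>) \<longleftrightarrow>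
    Des p w \<subseteq> partial_sums \<gamma> \<and> Des q (\<lambda>i. w (i + p)) \<subseteq> partial_sums \<delta>" (is "?L \<longleftrightarrow> ?R")
  proof
    assume L: ?L
    have "i \<in> partial_sums \<gamma>" if "i \<in> Des p w" for i
    proof -
      have "i \<in> Des (p + q) w" "0 < i" "i < p" using that by (auto simp: Des_def)
      with L partial_sums_append_cases[OF assms, of i] show ?thesis by auto
    qed
    moreover have "i \<in> partial_sums \<delta>" if "i \<in> Des q (\<lambda>i. w (i + p))" for i
    proof -
      have "i + p \<in> Des (p + q) w" "0 < i" "i < q" using that by (auto simp: Des_def)
      with L partial_sums_append_cases[OF assms, of "i + p"] show ?thesis by auto
    qed
    ultimately show ?R by blast
  next
    assume R: ?R
    show ?L
    proof
      fix i assume "i \<in> Des (p + q) w"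
      then have i: "0 < i" "i < p + q" "w i > w (i + 1)" by (auto simp: Des_def)
      consider "i < p" | "i = p" | j where "i = p + j" "j > 0"
        by (metis less_imp_add_positive linorder_neqE_nat)
      then show "i \<in> partial_sums (\<gamma> @ \<delta>)"
      proof cases
        case 1
        with i have "i \<in> Des p w" by (auto simp: Des_def)
        with 1 R i show ?thesis by (auto simp: partial_sums_append_cases[OF assms])
      next
        case 2
        with i show ?thesis by (auto simp: partial_sums_append_cases[OF assms])
      next
        case (3 j)
        with i have "j \<in> Des q (\<lambda>i. w (i + p))" by (auto simp: Des_def add.commute)
        with 3 R i show ?thesis by (auto simp: partial_sums_append_cases[OF assms])
      qed
    qed
  qed
  with assms c show ?thesis by (simp add: F_D_mon)
qed

text \<open>By \<open>F_D_mon_append\<close> the double sum separates into a product of two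
  expansions, one for the prefix and one for the suffix.\<close>

lemma End_F_append:
  assumes \<Phi>: "\<Phi> \<in> QSym_End" and \<alpha>: "\<alpha> \<in> Comp p" and \<beta>: "\<beta> \<in> Comp q"
  shows "\<Phi> (F (D (p + q) w)) (mon (\<alpha> @ \<beta>)) =
    \<Phi> (F (D p w)) (mon \<alpha>) * \<Phi> (F (D q (\<lambda>i. w (i + p)))) (mon \<beta>)"
  unfolding End_apply_append[OF \<Phi> F_D_in_Q \<alpha> \<beta>]
  unfolding End_Q_expand[OF \<Phi> F_D_in_Q] sum_product
  by (intro sum.cong) (simp_all add: F_D_mon_append)

lemma H_in_Q: "inj_on w {1..n} \<Longrightarrow> H n S w \<in> Q n"
  using F_D_in_Q by (auto simp: H_eq_sum_F Q_def intro: fs.span_sum)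

lemma H_cong:
  assumes "\<And>i. 1 \<le> i \<Longrightarrow> i < n \<Longrightarrow> i \<in> S \<longleftrightarrow> i \<in> S'"
  shows "H n S w = H n S' w"
proof -
  have "lexfuns n S w = lexfuns n S' w"
    using assms unfolding lexfuns_def by blast
  then show ?thesis by (simp add: H_def)
qed

text \<open>Induction on the parts: \<open>End_F_append\<close> splits off the first segment of
  \<open>w\<close>, and multiplicativity of \<psi> merges the factors into one value, taken at the
  product of the fundamental series of the segments.\<close>

lemma End_F_mon:
  assumes \<Phi>: "\<Phi> \<in> QSym_End" and "inj_on w {1..n}" "\<beta> \<in> Comp n"
  shows "\<Phi> (F (D n w)) (mon \<beta>) = \<Phi> (H n (partial_sums \<beta>) w) (replicate_mset n 0)"
  using assms(2,3)
proof (induction \<beta> arbitrary: n w)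
  case Nil
  then have "n = 0" by (simp add: Comp_def)
  then show ?case by (simp add: H_empty)
next
  case (Cons b \<beta>)
  define q where "q = sum_list \<beta>"
  have n: "n = b + q" and b: "[b] \<in> Comp b" and \<beta>: "\<beta> \<in> Comp q"
    using Cons.prems by (auto simp: Comp_def q_def)
  let ?w' = "\<lambda>i. w (i + b)"
  have inj: "inj_on w {1..b}" "inj_on ?w' {1..q}"
  proof -
    show "inj_on w {1..b}" by (rule inj_on_subset[OF Cons.prems(1)]) (simp add: n)
    show "inj_on ?w' {1..q}"
      using inj_onD[OF Cons.prems(1), of "_ + b" "_ + b"] by (intro inj_onI) (simp add: n)
  qed
  have "\<Phi> (F (D n w)) (mon (b # \<beta>)) = \<Phi> (F (D b w)) (mon [b]) * \<Phi> (F (D q ?w')) (mon \<beta>)"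
    using End_F_append[OF \<Phi> b \<beta>, of w] by (simp add: n)
  also have "\<dots> = \<Phi> (H b {} w) (replicate_mset b 0) * \<Phi> (H q (partial_sums \<beta>) ?w') (replicate_mset q 0)"
    by (simp add: Cons.IH[OF inj(2) \<beta>] H_empty[OF inj(1)] mon_singleton)
  also have "\<dots> = (\<Phi> (H b {} w) \<odot> \<Phi> (H q (partial_sums \<beta>) ?w')) (replicate_mset n 0)"
    unfolding n by (intro series_mult_replicate[symmetric] QSym_EndD(3)[OF \<Phi>] H_in_Q inj)
  also have "\<dots> = \<Phi> (H b {} w \<odot> H q (partial_sums \<beta>) ?w') (replicate_mset n 0)"
    using H_in_Q[OF inj(1)] H_in_Q[OF inj(2)] Q_subset_QSym by (subst QSym_EndD(5)[OF \<Phi>]) blast+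
  also have "H b {} w \<odot> H q (partial_sums \<beta>) ?w' = H n (insert b ((+) b ` partial_sums \<beta>)) w"
    by (simp add: series_mult_H n)
  \<comment> \<open>If \<beta> is empty, the inserted cut is \<open>b = n\<close>, which
    \<open>partial_sums\<close> leaves out; \<open>H\<close> looks only at positions below
    \<open>n\<close>.\<close>
  also have "\<dots> = H n (partial_sums (b # \<beta>)) w"
  proof (rule H_cong)
    fix i assume "i < n"
    then show "i \<in> insert b ((+) b ` partial_sums \<beta>) \<longleftrightarrow> i \<in> partial_sums (b # \<beta>)"
      by (cases "\<beta> = []") (auto simp: partial_sums_Cons n q_def)
  qed
  finally show ?case .
qed

text \<open>Both sides are compared at \<open>mon \<beta>\<close>. By \<open>End_F_mon\<close> and
  the shuffle rule the left side is a sum over the \<sigma> with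
  \<open>Des n \<sigma> \<subseteq> partial_sums \<beta>\<close>, and these are the \<sigma> whose
  \<open>F (D n \<sigma>)\<close> is 1 there.\<close>

lemma End_F_eq:
  assumes \<Phi>: "\<Phi> \<in> QSym_End" and w: "inj_on w {1..n}"
  shows "\<Phi> (F (D n w)) = (\<Sum>\<sigma>\<in>{\<sigma>. \<sigma> permutes {1..n}}.
    \<Phi> (F (D n (w \<circ> inv \<sigma>))) (replicate_mset n 0) *\<^sub>f F (D n \<sigma>))"
proof (rule Q_eqI)
  show "\<Phi> (F (D n w)) \<in> Q n" by (intro QSym_EndD(3)[OF \<Phi>] F_D_in_Q)
  let ?a = "\<lambda>\<sigma>. \<Phi> (F (D n (w \<circ> inv \<sigma>))) (replicate_mset n 0)"
  show "(\<Sum>\<sigma>\<in>{\<sigma>. \<sigma> permutes {1..n}}. ?a \<sigma> *\<^sub>f F (D n \<sigma>)) \<in> Q n"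
    using F_D_in_Q unfolding Q_def by (intro fs.span_sum fs.span_scale) blast
  fix \<beta> assume \<beta>: "\<beta> \<in> Comp n"
  let ?P = "{\<sigma>. \<sigma> permutes {1..n} \<and> Des n \<sigma> \<subseteq> partial_sums \<beta>}"
  \<comment> \<open>The factor 1 gives the sum the form of \<open>End_sum\<close>.\<close>
  have "\<Phi> (F (D n w)) (mon \<beta>) = \<Phi> (\<Sum>\<sigma>\<in>?P. 1 *\<^sub>f F (D n (w \<circ> inv \<sigma>))) (replicate_mset n 0)"
    by (simp add: End_F_mon[OF \<Phi> w \<beta>] H_eq_sum_F[OF w])
  also have "\<dots> = (\<Sum>\<sigma>\<in>?P. ?a \<sigma>)"
    using F_D_in_Q Q_subset_QSym by (subst End_sum[OF \<Phi>]) (auto simp: sum_fun_apply)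
  also have "\<dots> = (\<Sum>\<sigma>\<in>{\<sigma>. \<sigma> permutes {1..n}}. ?a \<sigma> * F (D n \<sigma>) (mon \<beta>))"
    using finite_permutations[of "{1..n}"]
    by (intro sum.mono_neutral_cong_left) (auto simp: F_D_mon[OF \<beta>])
  finally show "\<Phi> (F (D n w)) (mon \<beta>)
      = (\<Sum>\<sigma>\<in>{\<sigma>. \<sigma> permutes {1..n}}. ?a \<sigma> *\<^sub>f F (D n \<sigma>)) (mon \<beta>)"
    by (simp add: sum_fun_apply)
qed

section \<open>The coefficient of \<open>F (one_part n)\<close> and the normalising constant\<close>

text \<open>Triangularity: \<open>F \<gamma>\<close> is nonzero at \<open>mon \<beta>\<close> only
  if the cuts of \<gamma> are among those of \<beta>. For a \<beta> with fewest cuts among the terms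
  present, evaluation at \<open>mon \<beta>\<close> isolates its coefficient.\<close>

lemma independent_F: "fs.independent (F ` Compositions)"
  unfolding fs.dependent_explicit
proof clarify
  fix T u v assume T: "finite T" "T \<subseteq> F ` Compositions" and z: "(\<Sum>v\<in>T. u v *\<^sub>f v) = 0"
    and v: "v \<in> T" "u v \<noteq> 0"
  let ?P = "\<lambda>\<beta>. \<beta> \<in> Compositions \<and> F \<beta> \<in> T \<and> u (F \<beta>) \<noteq> 0"
  obtain \<beta>\<^sub>0 where "?P \<beta>\<^sub>0" using T v by blast
  then obtain \<beta> where \<beta>: "?P \<beta>"
    and min: "\<And>\<gamma>. ?P \<gamma> \<Longrightarrow> card (partial_sums \<beta>) \<le> card (partial_sums \<gamma>)"
    using ex_has_least_nat[of ?P \<beta>\<^sub>0 "\<lambda>\<beta>. card (partial_sums \<beta>)"] by blast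
  have ap: "F \<gamma> (mon \<beta>)
      = (if sum_list \<beta> = sum_list \<gamma> \<and> partial_sums \<gamma> \<subseteq> partial_sums \<beta> then 1 else 0)"
    if "\<gamma> \<in> Compositions" for \<gamma>
    using F_apply[of \<gamma> "sum_list \<gamma>" "mon \<beta>"] size_mon[of \<beta> "sum_list \<beta>"] that \<beta>
    by (simp add: Compositions_iff Comp_def content_mon)
  have fin: "finite (partial_sums \<beta>)" by (simp add: partial_sums_def)
  have "u v * v (mon \<beta>) = 0" if "v \<in> T - {F \<beta>}" for v
  proof (rule ccontr)
    assume nz: "u v * v (mon \<beta>) \<noteq> 0"
    obtain \<gamma> where \<gamma>: "\<gamma> \<in> Compositions" "v = F \<gamma>"
      using \<open>v \<in> T - {F \<beta>}\<close> T(2) by blast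
    with nz ap[of \<gamma>] have le: "sum_list \<beta> = sum_list \<gamma>" "partial_sums \<gamma> \<subseteq> partial_sums \<beta>"
      by (auto split: if_splits)
    have "?P \<gamma>" using \<gamma> that nz by auto
    from min[OF this] have "partial_sums \<gamma> = partial_sums \<beta>"
      using card_seteq[OF fin le(2)] by simp
    with le \<gamma> \<beta> have "\<gamma> = \<beta>" by (intro partial_sums_inj) (auto simp: Compositions_iff)
    with \<gamma> that show False by simp
  qed
  then have "(\<Sum>v\<in>T. u v * v (mon \<beta>)) = (\<Sum>v\<in>{F \<beta>}. u v * v (mon \<beta>))"
    using T \<beta> by (intro sum.mono_neutral_right) auto
  then have "(\<Sum>v\<in>T. u v *\<^sub>f v) (mon \<beta>) = u (F \<beta>)"
    using ap[of \<beta>] \<beta> by (simp add: sum_fun_apply)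
  with z \<beta> show False by simp
qed

lemma content_replicate: "content (replicate_mset n 0) = one_part n"
  using content_mon[OF Comp_no_zero[OF one_part_in_Comp]] by (simp add: mon_one_part)

lemma partial_sums_one_part [simp]: "partial_sums (one_part n) = {}"
  by (simp add: one_part_def)

lemma F_replicate:
  assumes "\<beta> \<in> Compositions"
  shows "F \<beta> (replicate_mset n 0) = (if \<beta> = one_part n then 1 else 0)"
proof -
  have \<beta>: "\<beta> \<in> Comp (sum_list \<beta>)" using assms by (simp add: Compositions_iff Comp_def)
  have "n = sum_list \<beta> \<and> partial_sums \<beta> = {} \<longleftrightarrow> \<beta> = one_part n"
  proof
    assume "n = sum_list \<beta> \<and> partial_sums \<beta> = {}"
    then show "\<beta> = one_part n"
      using inj_onD[OF inj_on_partial_sums, of \<beta> "one_part n" n] \<beta> one_part_in_Comp by simp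
  next
    assume "\<beta> = one_part n"
    then show "n = sum_list \<beta> \<and> partial_sums \<beta> = {}" by (simp add: one_part_def)
  qed
  then show ?thesis by (simp add: F_apply[OF \<beta>] content_replicate)
qed

text \<open>By \<open>F_replicate\<close>, \<open>F (one_part n)\<close> is the only fundamental
  series containing the \<open>n\<close>-th power of the first variable.\<close>

lemma representation_F_one_part:
  assumes "f \<in> fs.span (F ` Compositions)"
  shows "fs.representation (F ` Compositions) f (F (one_part n)) = f (replicate_mset n 0)"
proof -
  let ?r = "fs.representation (F ` Compositions) f"
  let ?T = "{v. ?r v \<noteq> 0}"
  have fin: "finite ?T" by (rule fs.finite_representation)
  have one: "one_part n \<in> Compositions" using one_part_in_Comp Comp_subset_Compositions by blast
  have "f (replicate_mset n 0) = (\<Sum>v\<in>?T. ?r v *\<^sub>f v) (replicate_mset n 0)"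
    by (simp only: fs.sum_nonzero_representation_eq[OF independent_F assms])
  also have "\<dots> = (\<Sum>v\<in>?T. ?r v * v (replicate_mset n 0))"
    by (simp add: sum_fun_apply)
  also have "\<dots> = (\<Sum>v\<in>?T. if v = F (one_part n) then ?r v else 0)"
  proof (rule sum.cong[OF refl])
    fix v assume "v \<in> ?T"
    then have "v \<in> F ` Compositions" using fs.representation_ne_zero by blast
    then show "?r v * v (replicate_mset n 0) = (if v = F (one_part n) then ?r v else 0)"
      using F_replicate F_replicate[OF one, of n] by (auto simp: image_iff split: if_splits)
  qed
  also have "\<dots> = ?r (F (one_part n))" using fin by simp
  finally show ?thesis ..
qed

lemma ex_permutation_D:
  assumes "\<alpha> \<in> Comp n"
  shows "\<exists>\<sigma>. \<sigma> permutes {1..n} \<and> D n \<sigma> = \<alpha>"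
proof -
  let ?S = "partial_sums \<alpha>"
  have S: "?S \<subseteq> {1..<n}"
    using assms partial_sums_bounds[of \<alpha>] by (fastforce simp: Comp_def)
  \<comment> \<open>The first component is constant between cuts and drops at each cut; the second
    makes the permutation increase in between.\<close>
  define key where "key = (\<lambda>i. (n - card (?S \<inter> {..<i}), i))"
  define \<sigma> where "\<sigma> = rank n key"
  have "inj_on key {1..n}" by (auto simp: inj_on_def key_def)
  then have \<sigma>: "\<sigma> permutes {1..n}" unfolding \<sigma>_def by (rule rank_permutes)
  have "i \<in> Des n \<sigma> \<longleftrightarrow> i \<in> ?S" if "1 \<le> i" "i < n" for i
  proof -
    have less: "\<sigma> (i + 1) < \<sigma> i \<longleftrightarrow> key (i + 1) < key i"
      unfolding \<sigma>_def using that by (intro rank_less_iff) auto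
    have "?S \<inter> {..<i + 1} = (if i \<in> ?S then insert i (?S \<inter> {..<i}) else ?S \<inter> {..<i})"
      by (auto simp: less_Suc_eq)
    then have "card (?S \<inter> {..<i + 1}) = (if i \<in> ?S then Suc (card (?S \<inter> {..<i})) else card (?S \<inter> {..<i}))"
      by simp
    \<comment> \<open>Keeps the truncated subtraction in \<open>key\<close> from hiding a
      drop.\<close>
    moreover have "card (?S \<inter> {..<i}) < n"
    proof -
      have "card (?S \<inter> {..<i}) \<le> card {1..<n}" using S by (intro card_mono) auto
      then show ?thesis using that by simp
    qed
    ultimately show ?thesis using that less by (auto simp: Des_def key_def)
  qed
  then have "Des n \<sigma> = ?S" using S by (auto simp: Des_def)
  with \<sigma> D_eqI[OF assms] show ?thesis by blast
qed

text \<open>\<open>representation\<close> is 0 outside the span, so membership has to be shown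
  first; \<open>End_F_eq\<close> provides it once \<alpha> is written as a descent
  composition.\<close>

lemma Fcoeff_one_part:
  assumes \<Phi>: "\<Phi> \<in> QSym_End" and \<alpha>: "\<alpha> \<in> Comp n"
  shows "Fcoeff \<Phi> \<alpha> (one_part n) = \<Phi> (F \<alpha>) (replicate_mset n 0)"
proof -
  obtain \<pi> where \<pi>: "\<pi> permutes {1..n}" "D n \<pi> = \<alpha>" using ex_permutation_D[OF \<alpha>] by blast
  have "F (D n \<sigma>) \<in> fs.span (F ` Compositions)" for \<sigma>
    using D_in_Comp Comp_subset_Compositions by (intro fs.span_base) blast
  then have "\<Phi> (F \<alpha>) \<in> fs.span (F ` Compositions)"
    unfolding \<pi>(2)[symmetric] End_F_eq[OF \<Phi> permutes_inj_on[OF \<pi>(1)]]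
    by (intro fs.span_sum fs.span_scale)
  then show ?thesis unfolding Fcoeff_def by (rule representation_F_one_part)
qed

lemma Comp_one: "Comp 1 = {[1]}"
proof -
  have "\<alpha> = [1]" if "\<alpha> \<in> Comp 1" for \<alpha>
  proof -
    have "partial_sums \<alpha> = {}" using that partial_sums_bounds[of \<alpha>] by (fastforce simp: Comp_def)
    then show ?thesis using that inj_onD[OF inj_on_partial_sums, of \<alpha> "[1]" 1] by (simp add: Comp_def)
  qed
  then show ?thesis by (auto simp: Comp_def)
qed

text \<open>Degree 1 has the single composition \<open>[1]\<close>, so \<open>M [1]\<close> is an
  eigenvector and the \<open>THE\<close> in \<open>eigen\<close> has a unique witness.\<close>

lemma eigen_eq:
  assumes \<Phi>: "\<Phi> \<in> QSym_End"
  shows "eigen \<Phi> = \<Phi> (M [1]) (mon [1])"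
  unfolding eigen_def
proof (rule the_equality)
  have "\<Phi> (M [1]) \<in> Q 1" by (intro QSym_EndD(3)[OF \<Phi>] M_in_Q) (simp add: Comp_def)
  from Q_expand[OF this] show "\<Phi> (M [1]) = \<Phi> (M [1]) (mon [1]) *\<^sub>f M [1]"
    by (simp only: Comp_one) simp
next
  fix l assume "\<Phi> (M [1]) = l *\<^sub>f M [1]"
  moreover have "M [1] (mon [1]) = 1" by (simp add: M_eq content_mon)
  ultimately show "l = \<Phi> (M [1]) (mon [1])" by simp
qed

lemma M_Nil: "M [] = series_one"
proof
  fix m
  have "content m = [] \<longleftrightarrow> m = {#}" by (auto simp: content_def)
  then show "M [] m = series_one m" by (auto simp: M_eq series_one_def)
qed

text \<open>Cut into segments of length 1, any word contributes one factor
  \<open>eigen \<Phi>\<close> per letter.\<close>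

lemma End_F_ones:
  assumes \<Phi>: "\<Phi> \<in> QSym_End"
  shows "\<Phi> (F (D n w)) (mon (replicate n 1)) = eigen \<Phi> ^ n"
proof (induction n arbitrary: w)
  case 0
  have "Comp 0 = {[]}" by (auto simp: Comp_def) (metis list.set_intros(1) neq_Nil_conv)
  then have "F (D 0 w) = series_one"
    using D_in_Comp[of 0 w] F_eq_sum[of "[]" 0] by (simp add: M_Nil)
  then show ?case by (simp add: QSym_EndD(4)[OF \<Phi>]) (simp add: series_one_def)
next
  case (Suc n)
  have "F (D 1 w) = M [1]"
    using D_in_Comp[of 1 w] F_eq_sum[of "[1]" 1] unfolding Comp_one by simp
  moreover have "[1] \<in> Comp 1" "replicate n 1 \<in> Comp n"
    by (auto simp: Comp_def sum_list_replicate)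
  ultimately show ?case
    using End_F_append[OF \<Phi>, of "[1]" 1 "replicate n 1" n w] Suc
    by (simp add: eigen_eq[OF \<Phi>])
qed

text \<open>\<open>End_F_eq\<close> for the identity word is evaluated at
  \<open>mon (replicate n 1)\<close>: every \<open>F (D n \<sigma>)\<close> is 1 there because every
  position is a cut, and \<open>End_F_ones\<close> gives the left side.\<close>

lemma sum_End_F:
  assumes \<Phi>: "\<Phi> \<in> QSym_End"
  shows "(\<Sum>\<sigma>\<in>{\<sigma>. \<sigma> permutes {1..n}}. \<Phi> (F (D n \<sigma>)) (replicate_mset n 0)) = eigen \<Phi> ^ n"
proof -
  let ?p = "\<lambda>\<sigma>. \<Phi> (F (D n \<sigma>)) (replicate_mset n 0)"
  have c: "replicate n 1 \<in> Comp n" by (auto simp: Comp_def sum_list_replicate)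
  have "Des n \<sigma> \<subseteq> partial_sums (replicate n 1)" for \<sigma>
    by (force simp: Des_def partial_sums_def sum_list_replicate)
  then have one: "F (D n \<sigma>) (mon (replicate n 1)) = 1" for \<sigma>
    using F_D_mon[OF c] by simp
  have "eigen \<Phi> ^ n = \<Phi> (F (D n id)) (mon (replicate n 1))"
    by (rule End_F_ones[OF \<Phi>, symmetric])
  also have "\<dots> = (\<Sum>\<sigma>\<in>{\<sigma>. \<sigma> permutes {1..n}}. ?p (inv \<sigma>))"
    by (subst End_F_eq[OF \<Phi> inj_on_id]) (simp add: sum_fun_apply one del: One_nat_def)
  also have "\<dots> = (\<Sum>\<sigma>\<in>{\<sigma>. \<sigma> permutes {1..n}}. ?p \<sigma>)"
    by (rule sum_permutations_inverse[symmetric])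
  finally show ?thesis ..
qed

section \<open>Lumping\<close>

lemma class_image_eq:
  assumes "partitioning \<Phi> n R" "A \<in> Comp n // R" "\<alpha> \<in> A"
  shows "class_image \<Phi> A = \<Phi> (F \<alpha>)"
proof -
  have "equiv (Comp n) R" using assms by (simp add: partitioning_def)
  moreover have "(SOME \<alpha>. \<alpha> \<in> A) \<in> A" using assms(3) by (rule someI)
  ultimately have "((SOME \<alpha>. \<alpha> \<in> A), \<alpha>) \<in> R"
    using assms in_quotient_imp_in_rel[of "Comp n" R A] by blast
  then show ?thesis using assms by (auto simp: partitioning_def class_image_def)
qed

lemma mem_class_iff:
  assumes "equiv A R" "x \<in> A" "B \<in> A // R"
  shows "x \<in> B \<longleftrightarrow> R `` {x} = B"
  using assms by (metis Image_singleton_iff equiv_class_eq_iff equiv_class_self quotientE)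

text \<open>Expanding \<open>\<Phi> (F (D n \<pi>))\<close> by \<open>End_F_eq\<close> and applying
  \<Phi> again turns each \<open>F (D n \<sigma>)\<close> into the basis vector of its class. The
  left side does not mention \<pi>, so the sum is the same throughout the class: lumpability before
  normalisation.\<close>

lemma dcoeff_eq:
  assumes \<Phi>: "\<Phi> \<in> QSym_End" and part: "partitioning \<Phi> n R"
    and A: "A \<in> Comp n // R" and B: "B \<in> Comp n // R"
    and \<pi>: "\<pi> permutes {1..n}" "D n \<pi> \<in> A"
  shows "dcoeff \<Phi> n R A B = (\<Sum>\<sigma>\<in>{\<sigma>. \<sigma> permutes {1..n} \<and> D n \<sigma> \<in> B}.
    \<Phi> (F (D n (\<pi> \<circ> inv \<sigma>))) (replicate_mset n 0))"
proof -
  let ?a = "\<lambda>\<sigma>. \<Phi> (F (D n (\<pi> \<circ> inv \<sigma>))) (replicate_mset n 0)"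
  let ?P = "{\<sigma>. \<sigma> permutes {1..n}}"
  let ?E = "class_image \<Phi> ` (Comp n // R)"
  let ?c = "\<lambda>\<sigma>. R `` {D n \<sigma>}"
  have eq: "equiv (Comp n) R" and inj: "inj_on (class_image \<Phi>) (Comp n // R)"
    and ind: "fs.independent ?E"
    using part by (simp_all add: partitioning_def)
  have c: "?c \<sigma> \<in> Comp n // R" for \<sigma> using D_in_Comp by (rule quotientI)
  have img: "class_image \<Phi> (?c \<sigma>) = \<Phi> (F (D n \<sigma>))" for \<sigma>
    by (rule class_image_eq[OF part c]) (rule equiv_class_self[OF eq D_in_Comp])
  have "\<Phi> (class_image \<Phi> A) = \<Phi> (\<Sum>\<sigma>\<in>?P. ?a \<sigma> *\<^sub>f F (D n \<sigma>))"
    using class_image_eq[OF part A \<pi>(2)] End_F_eq[OF \<Phi> permutes_inj_on[OF \<pi>(1)], of n] by simp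
  also have "\<dots> = (\<Sum>\<sigma>\<in>?P. ?a \<sigma> *\<^sub>f class_image \<Phi> (?c \<sigma>))"
    using F_D_in_Q Q_subset_QSym by (subst End_sum[OF \<Phi>]) (auto simp: img)
  finally have "dcoeff \<Phi> n R A B
      = fs.representation ?E (\<Sum>\<sigma>\<in>?P. ?a \<sigma> *\<^sub>f class_image \<Phi> (?c \<sigma>)) (class_image \<Phi> B)"
    by (simp only: dcoeff_def)
  also have "\<dots> = (\<Sum>\<sigma>\<in>?P. fs.representation ?E (?a \<sigma> *\<^sub>f class_image \<Phi> (?c \<sigma>)) (class_image \<Phi> B))"
    using c by (subst fs.representation_sum[OF ind]) (auto intro: fs.span_scale[OF fs.span_base])
  also have "\<dots> = (\<Sum>\<sigma>\<in>?P. if D n \<sigma> \<in> B then ?a \<sigma> else 0)"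
  proof (rule sum.cong[OF refl])
    fix \<sigma> assume "\<sigma> \<in> ?P"
    \<comment> \<open>Distinct classes give distinct basis vectors.\<close>
    have "class_image \<Phi> B = class_image \<Phi> (?c \<sigma>) \<longleftrightarrow> D n \<sigma> \<in> B"
      using inj_on_eq_iff[OF inj B c] mem_class_iff[OF eq D_in_Comp B] by auto
    moreover have "class_image \<Phi> (?c \<sigma>) \<in> ?E" using c by blast
    ultimately show "fs.representation ?E (?a \<sigma> *\<^sub>f class_image \<Phi> (?c \<sigma>)) (class_image \<Phi> B)
        = (if D n \<sigma> \<in> B then ?a \<sigma> else 0)"
      by (simp only: fs.representation_scale[OF ind fs.span_base] fs.representation_basis[OF ind]) simp
  qed
  also have "\<dots> = (\<Sum>\<sigma>\<in>{\<sigma>\<in>?P. D n \<sigma> \<in> B}. ?a \<sigma>)"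
    using finite_permutations[of "{1..n}"] by (intro sum.inter_filter[symmetric]) auto
  finally show ?thesis by simp
qed

text \<open>The inverses in \<open>K\<close> combine to the word
  \<open>\<pi> \<circ> inv \<sigma>\<close> of \<open>End_F_eq\<close>, and the denominator of
  \<open>Prob\<close> is evaluated by \<open>sum_End_F\<close>.\<close>

lemma K_eq:
  assumes \<Phi>: "\<Phi> \<in> QSym_End" and "\<pi> permutes {1..n}" "\<sigma> permutes {1..n}"
  shows "K n \<Phi> \<pi> \<sigma> = \<Phi> (F (D n (\<pi> \<circ> inv \<sigma>))) (replicate_mset n 0) / eigen \<Phi> ^ n"
proof -
  have "inv (\<sigma> \<circ> inv \<pi>) = \<pi> \<circ> inv \<sigma>"
    using o_inv_distrib[OF permutes_bij[OF assms(3)] permutes_bij[OF permutes_inv[OF assms(2)]]]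
    by (simp only: permutes_inv_inv[OF assms(2)])
  then show ?thesis
    by (simp only: K_def Prob_def Fcoeff_one_part[OF \<Phi> D_in_Comp] sum_End_F[OF \<Phi>])
qed

theorem theorem3p12:
  fixes \<Phi> :: "series \<Rightarrow> series" and n :: nat and R :: "(nat list \<times> nat list) set"
  assumes "\<Phi> \<in> QSym_End"
    and "partitioning \<Phi> n R"
    and "\<forall>\<alpha>\<in>Comp n. 0 \<le> Fcoeff \<Phi> \<alpha> (one_part n)"
    and "\<exists>\<alpha>\<in>Comp n. Fcoeff \<Phi> \<alpha> (one_part n) \<noteq> 0"
  shows "eigen \<Phi> ^ n \<noteq> 0 \<and>
    stochastic_on (Comp n // R) (Khat \<Phi> n R) \<and>
    (\<forall>A\<in>Comp n // R. \<forall>B\<in>Comp n // R. \<forall>\<pi> \<tau>.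
       \<pi> permutes {1..n} \<and> \<tau> permutes {1..n} \<and> D n \<pi> \<in> A \<and> D n \<tau> \<in> A \<longrightarrow>
       (\<Sum>\<sigma>\<in>{\<sigma>. \<sigma> permutes {1..n} \<and> D n \<sigma> \<in> B}. K n \<Phi> \<pi> \<sigma>) =
         (\<Sum>\<sigma>\<in>{\<sigma>. \<sigma> permutes {1..n} \<and> D n \<sigma> \<in> B}. K n \<Phi> \<tau> \<sigma>) \<and>
       (\<Sum>\<sigma>\<in>{\<sigma>. \<sigma> permutes {1..n} \<and> D n \<sigma> \<in> B}. K n \<Phi> \<tau> \<sigma>) = Khat \<Phi> n R A B)"
proof -
  note \<Phi> = assms(1) and part = assms(2)
  let ?P = "{\<sigma>. \<sigma> permutes {1..n}}" and ?E = "Comp n // R"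
  let ?p = "\<lambda>\<sigma>. \<Phi> (F (D n \<sigma>)) (replicate_mset n 0)"
  have eq: "equiv (Comp n) R" using part by (simp add: partitioning_def)
  have finP: "finite ?P" by (intro finite_permutations) simp
  have finE: "finite ?E"
    using eq by (intro finite_quotient) (auto simp: equiv_type)
  have nonneg: "0 \<le> ?p \<sigma>" for \<sigma>
    using assms(3) D_in_Comp[of n \<sigma>] Fcoeff_one_part[OF \<Phi> D_in_Comp] by metis
  obtain \<alpha> where "\<alpha> \<in> Comp n" "Fcoeff \<Phi> \<alpha> (one_part n) \<noteq> 0" using assms(4) by blast
  \<comment> \<open>Every composition is a descent composition, so nonvanishing on
    \<open>Comp n\<close> passes to permutations.\<close>
  moreover then obtain \<sigma>\<^sub>0 where "\<sigma>\<^sub>0 permutes {1..n}" "D n \<sigma>\<^sub>0 = \<alpha>" using ex_permutation_D by blast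
  ultimately have "\<exists>\<sigma>\<in>?P. ?p \<sigma> \<noteq> 0" using Fcoeff_one_part[OF \<Phi>] by auto
  then have "sum ?p ?P \<noteq> 0" using sum_nonneg_eq_0_iff[OF finP, of ?p] nonneg by auto
  moreover have "0 \<le> sum ?p ?P" by (intro sum_nonneg nonneg)
  ultimately have "0 < eigen \<Phi> ^ n" unfolding sum_End_F[OF \<Phi>] by linarith
  have lump: "(\<Sum>\<sigma>\<in>{\<sigma>. \<sigma> permutes {1..n} \<and> D n \<sigma> \<in> B}. K n \<Phi> \<pi> \<sigma>) = Khat \<Phi> n R A B"
    if "A \<in> ?E" "B \<in> ?E" "\<pi> permutes {1..n}" "D n \<pi> \<in> A" for A B \<pi>
    unfolding Khat_def dcoeff_eq[OF \<Phi> part that] sum_divide_distrib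
    using K_eq[OF \<Phi> that(3)] by (intro sum.cong) auto
  have "0 \<le> Khat \<Phi> n R A B" and "(\<Sum>B\<in>?E. Khat \<Phi> n R A B) = 1"
    if A: "A \<in> ?E" and B: "B \<in> ?E" for A B
  proof -
    obtain \<alpha> where "\<alpha> \<in> Comp n" "A = R `` {\<alpha>}" using A by (rule quotientE)
    then obtain \<pi> where \<pi>: "\<pi> permutes {1..n}" "D n \<pi> \<in> A"
      using ex_permutation_D equiv_class_self[OF eq] by metis
    have Kn: "0 \<le> K n \<Phi> \<pi> \<sigma>" if "\<sigma> permutes {1..n}" for \<sigma>
      using K_eq[OF \<Phi> \<pi>(1) that] nonneg \<open>0 < eigen \<Phi> ^ n\<close> by simp
    show "0 \<le> Khat \<Phi> n R A B"
      unfolding lump[OF A B \<pi>, symmetric] by (intro sum_nonneg) (use Kn in auto)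
    \<comment> \<open>The classes partition the permutations by descent composition, so the row of
      \<open>Khat\<close> regroups the row of \<open>K\<close> at \<pi>.\<close>
    have "(\<Sum>B\<in>?E. Khat \<Phi> n R A B) = (\<Sum>B\<in>?E. \<Sum>\<sigma>\<in>{\<sigma>\<in>?P. R `` {D n \<sigma>} = B}. K n \<Phi> \<pi> \<sigma>)"
      using lump[OF A _ \<pi>] mem_class_iff[OF eq D_in_Comp] by (intro sum.cong) auto
    also have "\<dots> = (\<Sum>\<sigma>\<in>?P. K n \<Phi> \<pi> \<sigma>)"
      using finP finE D_in_Comp by (intro sum.group) (auto intro: quotientI)
    also have "\<dots> = (\<Sum>\<sigma>\<in>?P. ?p (\<pi> \<circ> inv \<sigma>)) / eigen \<Phi> ^ n"
      unfolding sum_divide_distrib using K_eq[OF \<Phi> \<pi>(1)] by (intro sum.cong) auto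
    \<comment> \<open>Inversion and then left translation by \<pi> reindex the row to the
      normalising sum.\<close>
    also have "(\<Sum>\<sigma>\<in>?P. ?p (\<pi> \<circ> inv \<sigma>)) = (\<Sum>\<sigma>\<in>?P. ?p (\<pi> \<circ> \<sigma>))"
      by (rule sum_permutations_inverse[symmetric])
    also have "\<dots> = sum ?p ?P"
      by (rule setum_permutations_compose_left[OF \<pi>(1), symmetric])
    finally show "(\<Sum>B\<in>?E. Khat \<Phi> n R A B) = 1"
      using \<open>0 < eigen \<Phi> ^ n\<close> unfolding sum_End_F[OF \<Phi>] by (metis divide_self less_irrefl)
  qed
  then have "stochastic_on ?E (Khat \<Phi> n R)" using finE by (auto simp: stochastic_on_def)
  moreover have "eigen \<Phi> ^ n \<noteq> 0" using \<open>0 < eigen \<Phi> ^ n\<close> by (metis less_irrefl)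
  ultimately show ?thesis by (intro conjI ballI allI impI) (simp_all only: lump not_False_eq_True)
qed

end
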